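(* Let $n\ge 2$ and let $\phi_n$ be the (unitary) Jones–Wenzl representation of the braid group $\mathcal{B}_n$ associated with the $(3,6)$-quotient $\mathcal{H}_n(3,6)$, i.e. the homomorphism $\mathcal{B}_n\to \mathcal{H}_n(3,6)^\times$ given by $\sigma_i\mapsto$ (image of $g_i$ in $\mathcal{H}_n(3,6)$), where $\sigma_1,\dots,\sigma_{n-1}$ are the standard Artin generators. Then the image $\phi_n(\mathcal{B}_n)$ is a finite group.
   Context: For $q\in\mathbb{C}$, the Hecke algebra $\mathcal{H}_n(q)$ is the $\mathbb{C}$-algebra with generators $g_1,\dots,g_{n-1}$ and relations $g_ig_{i+1}g_i=g_{i+1}g_ig_{i+1}$ ($1\le i\le n-2$), $g_ig_j=g_jg_i$ ($|i-j|>1$), $(g_i+1)(g_i-q)=0$. Put $e_i=(q-g_i)/(1+q)$. For $\eta\in\mathbb{C}$ there is a unique linear functional $\mathrm{tr}$ on $\bigcup_n\mathcal{H}_n(q)$ (Ocneanu's Markov trace) with $\mathrm{tr}(1)=1$, $\mathrm{tr}(ab)=\mathrm{tr}(ba)$, and $\mathrm{tr}(xe_n)=\eta\,\mathrm{tr}(x)$ for $x\in\mathcal{H}_n(q)$. Take $q=e^{2\pi i/6}$ and $\eta=\frac{1-q^{1-k}}{(1+q)(1-q^k)}$ with $k=3$, which gives $\eta=1/2$. The $(3,6)$-quotient is $\mathcal{H}_n(3,6)=\mathcal{H}_n(q)/\mathrm{Ann}(\mathrm{tr})$, where $\mathrm{Ann}(\mathrm{tr})=\{a\in\mathcal{H}_n(q):\mathrm{tr}(ab)=0\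 \forall b\in\mathcal{H}_n(q)\}$; it is a semisimple algebra. *)

theory Defs
  imports Complex_Main "HOL-Combinatorics.Permutations"
begin

text \<open>Concrete model of the Hecke algebra H_n(q) as its (faithful) left regular
representation on the space of coefficient functions over the standard basis
T_w, w in S_n (permutations of {0..<n}).  Elements of H_n(q) are the operators
in the span of words in the generators.\<close>

type_synonym hvec = "(nat \<Rightarrow> nat) \<Rightarrow> complex"
type_synonym hop = "hvec \<Rightarrow> hvec"

definition hq :: complex where "hq = cis (2 * pi / 6)"

definition heta :: complex where
  "heta = (let k = (3::int) in (1 - hq powi (1 - k)) / ((1 + hq) * (1 - hq powi k)))"

definition perms :: "nat \<Rightarrow> (nat \<Rightarrow> nat) set" where
  "perms n = {p. p permutes {0..<n}}"

definition inv_len :: "nat \<Rightarrow> (nat \<Rightarrow> nat) \<Rightarrow> nat" where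
  "inv_len n p = card {(i, j). i < j \<and> j < n \<and> p j < p i}"

text \<open>Simple transposition s_i = (i-1 i) (0-indexed positions), 1 \<le> i \<le> n-1.\<close>
definition sgen :: "nat \<Rightarrow> nat \<Rightarrow> nat" where
  "sgen i = (\<lambda>k. if k = i - 1 then i else if k = i then i - 1 else k)"

text \<open>Left multiplication by g_i: T_s T_w = T_{sw} if l(sw) > l(w),
  else (q-1) T_w + q T_{sw}; so (g_i + 1)(g_i - q) = 0.\<close>
definition hgen :: "nat \<Rightarrow> nat \<Rightarrow> hop" where
  "hgen n i v u = (if u \<in> perms n then
      (if inv_len n (sgen i \<circ> u) < inv_len n u
       then v (sgen i \<circ> u) + (hq - 1) * v u
       else hq * v (sgen i \<circ> u))
     else 0)"

definition hunit :: "nat \<Rightarrow> hop" where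
  "hunit n v u = (if u \<in> perms n then v u else 0)"

definition word_op :: "nat \<Rightarrow> nat list \<Rightarrow> hop" where
  "word_op n ws = foldr (\<lambda>i acc. hgen n i \<circ> acc) ws (hunit n)"

definition hecke_sub :: "nat \<Rightarrow> nat \<Rightarrow> hop set" where
  "hecke_sub n m = {(\<lambda>v u. \<Sum>w\<in>W. c w * word_op n w v u) | W c.
      finite W \<and> W \<subseteq> lists {1..<m}}"

abbreviation hecke :: "nat \<Rightarrow> hop set" where
  "hecke n \<equiv> hecke_sub n n"

definition hinv :: "nat \<Rightarrow> nat \<Rightarrow> hop" where
  "hinv n i v u = (hgen n i v u - (hq - 1) * hunit n v u) / hq"

definition he :: "nat \<Rightarrow> nat \<Rightarrow> hop" where
  "he n i v u = (hq * hunit n v u - hgen n i v u) / (1 + hq)"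

definition braid_op :: "nat \<Rightarrow> (nat \<times> bool) list \<Rightarrow> hop" where
  "braid_op n bs = foldr (\<lambda>(i, b) acc. (if b then hgen n i else hinv n i) \<circ> acc) bs (hunit n)"

definition braid_image :: "nat \<Rightarrow> hop set" where
  "braid_image n = braid_op n ` lists ({1..<n} \<times> UNIV)"

definition markov_trace :: "nat \<Rightarrow> (hop \<Rightarrow> complex) \<Rightarrow> bool" where
  "markov_trace n tr \<longleftrightarrow>
     tr (hunit n) = 1 \<and>
     (\<forall>a\<in>hecke n. \<forall>b\<in>hecke n. \<forall>x y.
        tr (\<lambda>v u. x * a v u + y * b v u) = x * tr a + y * tr b) \<and>
     (\<forall>a\<in>hecke n. \<forall>b\<in>hecke n. tr (a \<circ> b) = tr (b \<circ> a)) \<and>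
     (\<forall>m. 1 \<le> m \<and> m < n \<longrightarrow> (\<forall>x\<in>hecke_sub n m. tr (x \<circ> he n m) = heta * tr x))"

text \<open>a ~ b iff a - b \<in> Ann(tr); the (3,6)-quotient is hecke n // ann_rel.\<close>
definition ann_rel :: "nat \<Rightarrow> (hop \<Rightarrow> complex) \<Rightarrow> (hop \<times> hop) set" where
  "ann_rel n tr = {(a, b). a \<in> hecke n \<and> b \<in> hecke n \<and>
      (\<forall>c\<in>hecke n. tr (a \<circ> c) = tr (b \<circ> c))}"

end

theory Submission
  imports Defs
begin

text \<open>The Hecke relations together with the Markov property determine the trace of every word in the
  generators.  With \<open>q = hq\<close>, these properties also hold for the canonical trace of the algebra of
  Goldschmidt and Jones, which has generators \<open>u\<^sub>i, v\<^sub>i\<close> of square \<open>- 1\<close> such that \<open>u\<^sub>i\<close>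
  and \<open>v\<^sub>j\<close> anticommute for \<open>\<bar>i - j\<bar> \<le> 1\<close> and all other pairs commute, if \<open>g\<^sub>i\<close> is sent to
  \<open>q\<^sup>2 h\<^sub>i\<close> with \<open>h\<^sub>i = (1 + u\<^sub>i) (1 + v\<^sub>i) / 2\<close>.  Hence the class of a braid modulo the
  annihilator depends only on its image in that algebra.  Conjugation by \<open>h\<^sub>i\<close> permutes the finitely
  many signed monomials, so up to elements centralizing all monomials there are finitely many
  products of the \<open>h\<^sub>i\<close>.  These products have real coefficients and are isometries of the
  regular representation, so after adjoining one more pair of generators a centralizing product
  is \<open>1\<close> or \<open>- 1\<close>.  The remaining scalar factors are cube roots of unity.\<close>

subsection \<open>Word functionals satisfying the Hecke relations\<close>

text \<open>The values on words of a linear functional on the Hecke algebra with parameter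
  \<open>q\<close>. Relations between arbitrary \<open>x\<close> and \<open>y\<close> make it vanish
  on the two-sided ideal they generate.\<close>

definition hecke_functional :: "complex \<Rightarrow> nat \<Rightarrow> (nat list \<Rightarrow> complex) \<Rightarrow> bool" where
  "hecke_functional q n d \<longleftrightarrow> (\<forall>x\<in>lists {1..<n}. \<forall>y\<in>lists {1..<n}.
     (\<forall>i\<in>{1..<n}. d (x @ i # i # y) = (q - 1) * d (x @ i # y) + q * d (x @ y)) \<and>
     (\<forall>i. 1 \<le> i \<and> Suc i < n \<longrightarrow>
        d (x @ i # Suc i # i # y) = d (x @ Suc i # i # Suc i # y)) \<and>
     (\<forall>i\<in>{1..<n}. \<forall>j\<in>{1..<n}. Suc i < j \<longrightarrow> d (x @ i # j # y) = d (x @ j # i # y)))"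

lemma hecke_functional_quadratic:
  assumes "hecke_functional q n d" "x \<in> lists {1..<n}" "y \<in> lists {1..<n}" "i \<in> {1..<n}"
  shows "d (x @ i # i # y) = (q - 1) * d (x @ i # y) + q * d (x @ y)"
  using assms unfolding hecke_functional_def by blast

lemma hecke_functional_braid:
  assumes "hecke_functional q n d" "x \<in> lists {1..<n}" "y \<in> lists {1..<n}" "1 \<le> i" "Suc i < n"
  shows "d (x @ i # Suc i # i # y) = d (x @ Suc i # i # Suc i # y)"
  using assms unfolding hecke_functional_def by blast

lemma hecke_functional_commute:
  assumes "hecke_functional q n d" "x \<in> lists {1..<n}" "y \<in> lists {1..<n}"
    "i \<in> {1..<n}" "j \<in> {1..<n}" "Suc i < j"
  shows "d (x @ i # j # y) = d (x @ j # i # y)"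
  using assms unfolding hecke_functional_def by blast

text \<open>Allows an induction over words in lower generators to be applied to a segment inside a
  longer word.\<close>

lemma hecke_functional_context:
  assumes d: "hecke_functional q n d" and a: "a \<in> lists {1..<n}" and b: "b \<in> lists {1..<n}"
  shows "hecke_functional q n (\<lambda>w. d (a @ w @ b))"
  unfolding hecke_functional_def
proof (intro ballI conjI allI impI)
  fix x y assume xy: "x \<in> lists {1..<n}" "y \<in> lists {1..<n}"
  then have l: "a @ x \<in> lists {1..<n}" "y @ b \<in> lists {1..<n}"
    using a b by auto
  show "d (a @ (x @ i # i # y) @ b) = (q - 1) * d (a @ (x @ i # y) @ b) + q * d (a @ (x @ y) @ b)"
    if "i \<in> {1..<n}" for i
    using hecke_functional_quadratic[OF d l that] by simp
  show "d (a @ (x @ i # Suc i # i # y) @ b) = d (a @ (x @ Suc i # i # Suc i # y) @ b)"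
    if "1 \<le> i \<and> Suc i < n" for i
    using hecke_functional_braid[OF d l, of i] that by simp
  show "d (a @ (x @ i # j # y) @ b) = d (a @ (x @ j # i # y) @ b)"
    if "i \<in> {1..<n}" "j \<in> {1..<n}" "Suc i < j" for i j
    using hecke_functional_commute[OF d l that] by simp
qed

lemma hecke_functional_diff:
  assumes "hecke_functional q n d" "hecke_functional q n e"
  shows "hecke_functional q n (\<lambda>w. d w - e w)"
  unfolding hecke_functional_def
proof (intro ballI conjI allI impI)
  fix x y assume l: "x \<in> lists {1..<n}" "y \<in> lists {1..<n}"
  show "d (x @ i # i # y) - e (x @ i # i # y) =
      (q - 1) * (d (x @ i # y) - e (x @ i # y)) + q * (d (x @ y) - e (x @ y))"
    if "i \<in> {1..<n}" for i
    by (simp add: assms[THEN hecke_functional_quadratic, OF l that] ring_distribs)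
  show "d (x @ i # Suc i # i # y) - e (x @ i # Suc i # i # y) =
      d (x @ Suc i # i # Suc i # y) - e (x @ Suc i # i # Suc i # y)"
    if "1 \<le> i \<and> Suc i < n" for i
    using assms[THEN hecke_functional_braid, OF l] that by simp
  show "d (x @ i # j # y) - e (x @ i # j # y) = d (x @ j # i # y) - e (x @ j # i # y)"
    if "i \<in> {1..<n}" "j \<in> {1..<n}" "Suc i < j" for i j
    using assms[THEN hecke_functional_commute, OF l that] by simp
qed

text \<open>Letters below \<open>m\<close> differ from \<open>M\<close> by at least 2, so
  \<open>M\<close> passes them one at a time; the letters already passed are collected in
  \<open>x\<close>.\<close>

lemma hecke_functional_commute_word:
  assumes d: "hecke_functional q n d" and M: "M < n" "Suc m = M"
    and p: "p \<in> lists {1..<m}" and x: "x \<in> lists {1..<n}" and y: "y \<in> lists {1..<n}"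
  shows "d (x @ M # p @ y) = d (x @ p @ M # y)"
  using p x
proof (induction p arbitrary: x rule: list.induct)
  case Nil
  then show ?case by simp
next
  case (Cons a p)
  then have a: "a \<in> {1..<n}" "M \<in> {1..<n}" "Suc a < M"
    and p: "p @ y \<in> lists {1..<n}" using M y by auto
  have "d (x @ M # (a # p) @ y) = d ((x @ [a]) @ M # p @ y)"
    using hecke_functional_commute[OF d Cons.prems(2) p a] by simp
  also have "\<dots> = d ((x @ [a]) @ p @ M # y)"
    using Cons a by (intro Cons.IH) auto
  finally show ?case by simp
qed

lemma count_list_split_first:
  assumes "count_list w M > 0"
  obtains x y where "w = x @ M # y" "M \<notin> set x" "count_list y M = count_list w M - 1"
proof -
  have "M \<in> set w" using assms by (metis count_notin less_irrefl)
  then obtain x y where xy: "w = x @ M # y" "M \<notin> set x"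
    using split_list_first by metis
  then show ?thesis using that[of x y] by (simp add: count_notin)
qed

lemma lists_mono_interval:
  assumes "w \<in> lists {1..m}" "m < n"
  shows "w \<in> lists {1..<n::nat}"
  using assms by (force simp: in_lists_conv_set)

lemma lists_avoid_top:
  assumes "w \<in> lists {1..Suc m}" "Suc m \<notin> set w"
  shows "w \<in> lists {1..m}"
  using assms by (auto simp: in_lists_conv_set) (metis le_SucE)

text \<open>The Hecke relations reduce every word to words in which the top generator occurs at most
  once: between two occurrences of the top generator one may assume, inductively, that the next
  lower generator occurs at most once, and then the quadratic or the braid relation applies.\<close>

lemma hecke_functional_vanishes:
  assumes "hecke_functional q n d" "m < n"
    and "\<And>w. w \<in> lists {1..m} \<Longrightarrow> count_list w m \<le> 1 \<Longrightarrow> d w = 0"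
    and "w \<in> lists {1..m}"
  shows "d w = 0"
  using assms
proof (induction m arbitrary: d w)
  case 0
  then show ?case by simp
next
  case (Suc m)
  define M where "M = Suc m"
  note d = Suc.prems(1)
  have Mn: "M < n" "Suc m = M" "M \<in> {1..<n}" using Suc.prems(2) by (auto simp: M_def)
  show ?case
    using Suc.prems(4)
  proof (induction "count_list w M" arbitrary: w rule: less_induct)
    case less
    show ?case
    proof (cases "count_list w M \<le> 1")
      case True
      then show ?thesis using Suc.prems(3) less.prems by (simp add: M_def)
    next
      case False
      then obtain x r where w: "w = x @ M # r" and xM: "M \<notin> set x"
        and cr: "count_list r M = count_list w M - 1"
        using count_list_split_first[of w M] by (metis le0 le_less_linear less_one nat_less_le)
      then have "count_list r M > 0" using False by simp
      then obtain y z where r: "r = y @ M # z" and yM: "M \<notin> set y"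
        using count_list_split_first[of r M] by metis
      have ls: "x \<in> lists {1..M}" "y \<in> lists {1..M}" "z \<in> lists {1..M}"
        using less.prems by (auto simp: w r M_def)
      then have y: "y \<in> lists {1..m}" using lists_avoid_top yM by (metis M_def)
      have ln: "x \<in> lists {1..<n}" "y \<in> lists {1..<n}" "z \<in> lists {1..<n}"
        using ls Mn lists_mono_interval by blast+
      \<comment> \<open>\<open>e\<close> evaluates \<open>d\<close> with a varying segment between
        the first two occurrences of \<open>M\<close>. The outer induction, on the top generator,
        applies to it.\<close>
      define e where "e = (\<lambda>w. d ((x @ [M]) @ w @ (M # z)))"
      have e: "hecke_functional q n e"
        unfolding e_def using ln Mn by (intro hecke_functional_context d) auto
      have low: "d v = 0" if "v \<in> lists {1..M}" "count_list v M < count_list w M" for v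
        using less.hyps[of v] that by (simp add: M_def)
      have cw: "count_list w M = Suc (Suc (count_list z M))"
        using xM yM by (simp add: w r count_notin)
      have "e y = 0"
      proof (rule Suc.IH[OF e _ _ y])
        show "m < n" using Mn by simp
        fix v assume v: "v \<in> lists {1..m}" and cv: "count_list v m \<le> 1"
        have vM: "M \<notin> set v" using v by (auto simp: M_def in_lists_conv_set)
        have vl: "v \<in> lists {1..M}" using v by (auto simp: M_def in_lists_conv_set)
        show "e v = 0"
        proof (cases "m \<in> set v")
          case False
          then have v': "v \<in> lists {1..<m}"
            using v by (auto simp: in_lists_conv_set) (metis le_neq_implies_less)
          have "e v = d (x @ v @ M # M # z)"
            unfolding e_def using hecke_functional_commute_word[OF d Mn(1,2) v' ln(1), of "M # z"]
              ln Mn by simp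
          also have "\<dots> = (q - 1) * d ((x @ v) @ M # z) + q * d ((x @ v) @ z)"
            using hecke_functional_quadratic[OF d, of "x @ v" z M] ln Mn
              lists_mono_interval[OF vl] by simp
          also have "d ((x @ v) @ M # z) = 0"
            using ls vl cw xM vM by (intro low) (auto simp: count_notin M_def)
          also have "d ((x @ v) @ z) = 0"
            using ls vl cw xM vM by (intro low) (auto simp: count_notin)
          finally show ?thesis by simp
        next
          case True
          then obtain p s where v_eq: "v = p @ m # s" by (metis split_list)
          have "m \<notin> set p" "m \<notin> set s"
            using cv by (auto simp: v_eq count_list_0_iff[symmetric])
          then have ps: "p \<in> lists {1..<m}" "s \<in> lists {1..<m}" and m1: "1 \<le> m"
            using v unfolding v_eq
            by (auto simp: in_lists_conv_set) (metis Un_iff le_neq_implies_less)+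
          have psn: "p \<in> lists {1..<n}" "s \<in> lists {1..<n}" "m \<in> {1..<n}"
            using v lists_mono_interval[of v m n] Mn(1,2) by (auto simp: v_eq)
          have "e v = d (x @ M # p @ (m # s @ M # z))"
            by (simp add: e_def v_eq)
          also have "\<dots> = d (x @ p @ M # (m # s @ M # z))"
            using psn ln Mn by (intro hecke_functional_commute_word[OF d Mn(1,2) ps(1)]) auto
          also have "\<dots> = d ((x @ p @ [M, m]) @ s @ M # z)" by simp
          also have "\<dots> = d ((x @ p @ [M, m]) @ M # s @ z)"
            using psn ln Mn
            by (intro hecke_functional_commute_word[OF d Mn(1,2) ps(2), symmetric]) auto
          \<comment> \<open>\<open>M m M\<close> becomes \<open>m M m\<close>, which has one
            \<open>M\<close> fewer, so the inner induction, on the number of \<open>M\<close>,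
            finishes.\<close>
          also have "\<dots> = d ((x @ p) @ m # M # m # (s @ z))"
            using hecke_functional_braid[OF d, of "x @ p" "s @ z" m] psn ln Mn m1 by simp
          also have "\<dots> = 0"
            using ls vl cw xM vM
            by (intro low) (auto simp: v_eq count_notin M_def)
          finally show ?thesis .
        qed
      qed
      then show ?thesis by (simp add: e_def w r)
    qed
  qed
qed

text \<open>Uniqueness of the Markov trace. Once a word has at most one top generator, cyclicity
  moves it to the end, the Markov property removes it, and a word in fewer generators remains. The
  empty word starts the induction.\<close>

lemma markov_functional_vanishes:
  assumes d: "hecke_functional q n d"
    and nil: "d [] = 0"
    and cyc: "\<And>x y. x \<in> lists {1..<n} \<Longrightarrow> y \<in> lists {1..<n} \<Longrightarrow> d (x @ y) = d (y @ x)"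
    and markov: "\<And>x m. m \<in> {1..<n} \<Longrightarrow> x \<in> lists {1..<m} \<Longrightarrow> d (x @ [m]) = c * d x"
    and w: "w \<in> lists {1..<n}"
  shows "d w = 0"
proof -
  have "\<forall>w\<in>lists {1..m}. d w = 0" if "m < n" for m
    using that
  proof (induction m)
    case 0
    then show ?case using nil by simp
  next
    case (Suc m)
    show ?case
    proof
      fix w assume w: "w \<in> lists {1..Suc m}"
      show "d w = 0"
      proof (rule hecke_functional_vanishes[OF d Suc.prems _ w])
        fix v assume v: "v \<in> lists {1..Suc m}" and cv: "count_list v (Suc m) \<le> 1"
        show "d v = 0"
        proof (cases "Suc m \<in> set v")
          case False
          then show ?thesis using lists_avoid_top[OF v] Suc by simp
        next
          case True
          then obtain x y where v_eq: "v = x @ Suc m # y" by (metis split_list)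
          then have "Suc m \<notin> set x" "Suc m \<notin> set y"
            using cv by (auto simp: count_list_0_iff[symmetric])
          then have yx: "y @ x \<in> lists {1..m}"
            using v lists_avoid_top[of "y @ x" m] by (auto simp: v_eq)
          have "d v = d ((y @ x) @ [Suc m])"
            using cyc[of "x @ [Suc m]" y] lists_mono_interval[OF v Suc.prems] by (simp add: v_eq)
          also have "\<dots> = c * d (y @ x)"
            using yx Suc.prems by (intro markov) (auto simp: atLeastLessThanSuc_atLeastAtMost)
          also have "\<dots> = 0" using Suc yx by simp
          finally show ?thesis .
        qed
      qed
    qed
  qed
  from this[of "n - 1"] w nil show ?thesis
    by (cases n) (auto simp: atLeastLessThanSuc_atLeastAtMost)
qed

subsection \<open>The Hecke relations in the left regular model\<close>

lemma sgen_simps [simp]: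
  "sgen i (i - Suc 0) = i" "sgen i i = i - Suc 0"
  "k \<noteq> i - Suc 0 \<Longrightarrow> k \<noteq> i \<Longrightarrow> sgen i k = k"
  by (auto simp: sgen_def)

lemma sgen_sgen [simp]: "sgen i (sgen i k) = k"
  by (simp add: sgen_def)

lemma sgen_comp_sgen [simp]: "sgen i \<circ> (sgen i \<circ> u) = u"
  by (simp add: fun_eq_iff)

lemma sgen_permutes: "i \<in> {1..<n} \<Longrightarrow> sgen i permutes {0..<n}"
  by (rule bij_imp_permutes, rule bij_betw_byWitness[where f' = "sgen i"])
     (auto simp: sgen_def)

lemma sgen_perms: "i \<in> {1..<n} \<Longrightarrow> u \<in> perms n \<Longrightarrow> sgen i \<circ> u \<in> perms n"
  using sgen_permutes permutes_compose unfolding perms_def by blast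

lemma sgen_less_iff:
  assumes "1 \<le> i" "{x, y} \<noteq> {i - 1, i}"
  shows "sgen i x < sgen i y \<longleftrightarrow> x < y"
proof -
  obtain k where k: "i = Suc k" using assms(1) by (cases i) auto
  then have "\<not> (x = k \<and> y = Suc k)" "\<not> (x = Suc k \<and> y = k)"
    using assms(2) by auto
  then show ?thesis unfolding k sgen_def by auto
qed

text \<open>Composing with \<open>sgen i\<close> exchanges the values \<open>i - 1\<close> and
  \<open>i\<close> and leaves the order of all other pairs of values alone. Hence exactly one
  inversion is gained or lost, at the positions of these two values.\<close>

lemma inv_len_sgen_less_iff:
  assumes u: "u \<in> perms n" and i: "i \<in> {1..<n}"
  shows "inv_len n (sgen i \<circ> u) < inv_len n u \<longleftrightarrow> inv u i < inv u (i - 1)"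
proof -
  define I where "I = (\<lambda>p. {(a, b). a < b \<and> b < n \<and> p b < (p a :: nat)})"
  have fin: "finite (I p)" for p
    by (rule finite_subset[of _ "{..<n} \<times> {..<n}"]) (auto simp: I_def)
  have p: "u permutes {0..<n}" using u by (simp add: perms_def)
  define a b where "a = inv u (i - 1)" and "b = inv u i"
  have ua: "u a = i - 1" and ub: "u b = i"
    unfolding a_def b_def using permutes_inverses(1)[OF p] by auto
  have ia: "u k = i - 1 \<longleftrightarrow> k = a" "u k = i \<longleftrightarrow> k = b" for k
    using permutes_inverses(2)[OF p, of k] ua ub unfolding a_def b_def by metis+
  have "a \<noteq> b" using ua ub i by auto
  have "a < n" "b < n"
    using permutes_in_image[OF p, of a] permutes_in_image[OF p, of b] ua ub i by auto
  have rel: "(sgen i \<circ> u) l < (sgen i \<circ> u) k \<longleftrightarrow> u l < u k"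
    if "{k, l} \<noteq> {a, b}" for k l
  proof -
    have "{u k, u l} \<noteq> {i - 1, i}"
      using that ia[of k] ia[of l] by (metis doubleton_eq_iff)
    then show ?thesis using sgen_less_iff[of i "u l" "u k"] i by (simp add: insert_commute)
  qed
  have relab: "(sgen i \<circ> u) a = i" "(sgen i \<circ> u) b = i - 1"
    using ua ub i by auto
  show ?thesis
  proof (cases "b < a")
    case True
    have "I u = insert (b, a) (I (sgen i \<circ> u))"
    proof (intro set_eqI, clarify)
      fix k l
      show "(k, l) \<in> I u \<longleftrightarrow> (k, l) \<in> insert (b, a) (I (sgen i \<circ> u))"
      proof (cases "{k, l} = {a, b}")
        case True
        then show ?thesis
          using \<open>b < a\<close> \<open>a < n\<close> ua ub relab i
          by (auto simp del: o_apply simp: doubleton_eq_iff I_def)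
      next
        case False
        then show ?thesis
          using rel[OF False] by (auto simp del: o_apply simp: I_def)
      qed
    qed
    moreover have "(b, a) \<notin> I (sgen i \<circ> u)"
      using relab i by (auto simp: I_def simp del: o_apply)
    ultimately have "card (I u) = Suc (card (I (sgen i \<circ> u)))"
      using fin by simp
    then show ?thesis
      using True by (simp add: inv_len_def I_def a_def b_def)
  next
    case False
    then have ab: "a < b" using \<open>a \<noteq> b\<close> by simp
    have "I (sgen i \<circ> u) = insert (a, b) (I u)"
    proof (intro set_eqI, clarify)
      fix k l
      show "(k, l) \<in> I (sgen i \<circ> u) \<longleftrightarrow> (k, l) \<in> insert (a, b) (I u)"
      proof (cases "{k, l} = {a, b}")
        case True
        then show ?thesis
          using ab \<open>b < n\<close> ua ub relab i
          by (auto simp del: o_apply simp: doubleton_eq_iff I_def)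
      next
        case False
        then show ?thesis
          using rel[OF False] by (auto simp del: o_apply simp: I_def)
      qed
    qed
    moreover have "(a, b) \<notin> I u"
      using ua ub by (auto simp: I_def)
    ultimately have "card (I (sgen i \<circ> u)) = Suc (card (I u))"
      using fin by simp
    then show ?thesis
      using False by (simp add: inv_len_def I_def a_def b_def)
  qed
qed

lemma inv_sgen_comp:
  assumes "u \<in> perms n" "i \<in> {1..<n}"
  shows "inv (sgen i \<circ> u) k = inv u (sgen i k)"
proof -
  have "bij u" "bij (sgen i)"
    using assms sgen_permutes permutes_bij by (auto simp: perms_def)
  moreover have "inv (sgen i) = sgen i"
    by (rule inv_equality) auto
  ultimately show ?thesis by (simp add: o_inv_distrib)
qed

lemma inv_perms_neq:
  assumes "u \<in> perms n" "k \<noteq> l"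
  shows "inv u k \<noteq> inv u l"
  using assms permutes_inverses(1) unfolding perms_def by (metis mem_Collect_eq)

text \<open>In this form the condition can be evaluated after further compositions, since
  \<open>inv (sgen i \<circ> u)\<close> is \<open>inv u\<close> with two arguments
  exchanged.\<close>

lemma hgen_eq:
  assumes "u \<in> perms n" "i \<in> {1..<n}"
  shows "hgen n i v u = (if inv u i < inv u (i - 1) then v (sgen i \<circ> u) + (hq - 1) * v u
      else hq * v (sgen i \<circ> u))"
  using assms inv_len_sgen_less_iff[OF assms] by (simp add: hgen_def)

lemma hgen_outside: "u \<notin> perms n \<Longrightarrow> hgen n i v u = 0"
  by (simp add: hgen_def)

lemma hgen_quadratic:
  assumes i: "i \<in> {1..<n}"
  shows "hgen n i (hgen n i v) u = (hq - 1) * hgen n i v u + hq * hunit n v u"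
proof (cases "u \<in> perms n")
  case True
  have "inv u i \<noteq> inv u (i - 1)" using i by (intro inv_perms_neq[OF True]) auto
  then show ?thesis
    using True i
    by (cases "inv u i < inv u (i - 1)")
       (simp_all add: hgen_eq sgen_perms inv_sgen_comp[of _ n] hunit_def distrib_left)
qed (simp_all add: hgen_outside hunit_def)

lemma sgen_commute:
  assumes "1 \<le> i" "Suc i < j"
  shows "sgen i \<circ> (sgen j \<circ> u) = sgen j \<circ> (sgen i \<circ> u)"
proof -
  obtain k l where "i = Suc k" "j = Suc l" using assms by (cases i; cases j) auto
  then show ?thesis using assms by (auto simp: fun_eq_iff sgen_def)
qed

lemma hgen_commute:
  assumes i: "i \<in> {1..<n}" and j: "j \<in> {1..<n}" and ij: "Suc i < j"
  shows "hgen n i (hgen n j v) u = hgen n j (hgen n i v) u"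
proof (cases "u \<in> perms n")
  case True
  have s: "sgen j i = i" "sgen j (i - 1) = i - 1" "sgen i j = j" "sgen i (j - 1) = j - 1"
    using ij by (auto simp: sgen_def)
  define S T where "S = sgen i" and "T = sgen j"
  have inv: "inv (S \<circ> w) l = inv w (S l)" "inv (T \<circ> w) l = inv w (T l)"
    if "w \<in> perms n" for w l
    using inv_sgen_comp[OF that] i j by (simp_all add: S_def T_def)
  have mem: "S \<circ> w \<in> perms n" "T \<circ> w \<in> perms n" if "w \<in> perms n" for w
    using sgen_perms[OF _ that] i j by (simp_all add: S_def T_def)
  have G: "hgen n i v w = (if inv w i < inv w (i - 1) then v (S \<circ> w) + (hq - 1) * v w
      else hq * v (S \<circ> w))"
    "hgen n j v w = (if inv w j < inv w (j - 1) then v (T \<circ> w) + (hq - 1) * v w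
      else hq * v (T \<circ> w))"
    if "w \<in> perms n" for v w
    using hgen_eq[OF that] i j by (simp_all add: S_def T_def)
  have comm: "S \<circ> (T \<circ> u) = T \<circ> (S \<circ> u)"
    using sgen_commute[of i j u] i ij by (simp add: S_def T_def)
  note eqs = True G mem inv s[folded S_def T_def] comm if_True if_False
  show ?thesis
    by (cases "inv u i < inv u (i - 1)"; cases "inv u j < inv u (j - 1)";
        simp only: eqs; simp only: distrib_left add.assoc add.commute add.left_commute
          mult.assoc mult.commute mult.left_commute)
qed (simp_all add: hgen_outside)

lemma sgen_braid:
  assumes "1 \<le> i"
  shows "sgen i \<circ> (sgen (Suc i) \<circ> (sgen i \<circ> u)) = sgen (Suc i) \<circ> (sgen i \<circ> (sgen (Suc i) \<circ> u))"
proof -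
  obtain k where "i = Suc k" using assms by (cases i) auto
  then show ?thesis by (auto simp: fun_eq_iff sgen_def)
qed

text \<open>The case conditions met on both sides depend only on the relative order of the positions
  of the three values \<open>i - 1\<close>, \<open>i\<close> and \<open>i + 1\<close>. Each of the
  six orders is a direct expansion.\<close>

lemma hgen_braid:
  assumes i: "1 \<le> i" "Suc i < n"
  shows "hgen n i (hgen n (Suc i) (hgen n i v)) u = hgen n (Suc i) (hgen n i (hgen n (Suc i) v)) u"
proof (cases "u \<in> perms n")
  case True
  obtain k where k: "i = Suc k" using i by (cases i) auto
  have ii: "Suc k \<in> {1..<n}" "Suc (Suc k) \<in> {1..<n}" using i k by auto
  define a b c where "a = inv u k" and "b = inv u (Suc k)" and "c = inv u (Suc (Suc k))"
  note abc = a_def[symmetric] b_def[symmetric] c_def[symmetric]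
  have ne: "a \<noteq> b" "b \<noteq> c" "a \<noteq> c"
    unfolding a_def b_def c_def by (auto intro!: inv_perms_neq[OF True])
  define S T where "S = sgen (Suc k)" and "T = sgen (Suc (Suc k))"
  have s: "S k = Suc k" "S (Suc k) = k" "S (Suc (Suc k)) = Suc (Suc k)"
    "T k = k" "T (Suc k) = Suc (Suc k)" "T (Suc (Suc k)) = Suc k"
    by (auto simp: sgen_def S_def T_def)
  have inv: "inv (S \<circ> w) l = inv w (S l)" "inv (T \<circ> w) l = inv w (T l)"
    if "w \<in> perms n" for w l
    using inv_sgen_comp[OF that] ii by (simp_all add: S_def T_def)
  have mem: "S \<circ> w \<in> perms n" "T \<circ> w \<in> perms n" if "w \<in> perms n" for w
    using sgen_perms[OF _ that] ii by (simp_all add: S_def T_def)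
  have G: "hgen n (Suc k) v w = (if inv w (Suc k) < inv w k then v (S \<circ> w) + (hq - 1) * v w
      else hq * v (S \<circ> w))"
    "hgen n (Suc (Suc k)) v w = (if inv w (Suc (Suc k)) < inv w (Suc k)
      then v (T \<circ> w) + (hq - 1) * v w else hq * v (T \<circ> w))"
    if "w \<in> perms n" for v w
    using hgen_eq[OF that] ii by (simp_all add: S_def T_def)
  have braid: "S \<circ> (T \<circ> (S \<circ> u)) = T \<circ> (S \<circ> (T \<circ> u))"
    using sgen_braid[of "Suc k" u] by (simp add: S_def T_def)
  have invol: "S \<circ> (S \<circ> w) = w" "T \<circ> (T \<circ> w) = w" for w
    by (simp_all add: S_def T_def)
  note eqs = True G mem inv s abc braid invol if_True if_False
  note ring = distrib_left add.assoc add.commute add.left_commute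
    mult.assoc mult.commute mult.left_commute
  consider "a < b" "b < c" | "a < c" "c < b" | "b < a" "a < c"
    | "c < a" "a < b" | "b < c" "c < a" | "c < b" "b < a"
    using ne by (metis linorder_neqE_nat)
  then show ?thesis
  proof cases
    case 1
    then have "a < b" "a < c" "b < c" "\<not> b < a" "\<not> c < a" "\<not> c < b"
      by simp_all
    then show ?thesis unfolding k by (simp only: eqs)
  next
    case 2
    then have "a < c" "a < b" "c < b" "\<not> c < a" "\<not> b < a" "\<not> b < c"
      by simp_all
    then show ?thesis unfolding k by (simp only: eqs) (simp only: ring)
  next
    case 3
    then have "b < a" "b < c" "a < c" "\<not> a < b" "\<not> c < b" "\<not> c < a"
      by simp_all
    then show ?thesis unfolding k by (simp only: eqs) (simp only: ring)
  next
    case 4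
    then have "c < a" "c < b" "a < b" "\<not> a < c" "\<not> b < c" "\<not> b < a"
      by simp_all
    then show ?thesis unfolding k by (simp only: eqs) (simp only: ring)
  next
    case 5
    then have "b < c" "b < a" "c < a" "\<not> c < b" "\<not> a < b" "\<not> a < c"
      by simp_all
    then show ?thesis unfolding k by (simp only: eqs) (simp only: ring)
  next
    case 6
    then have "c < b" "c < a" "b < a" "\<not> b < c" "\<not> a < c" "\<not> a < b"
      by simp_all
    then show ?thesis unfolding k by (simp only: eqs) (simp only: ring)
  qed
qed (simp_all add: hgen_outside)

subsection \<open>Linear operators on real functions\<close>

text \<open>The algebra of Goldschmidt and Jones is realized by operators, so associativity is that
  of composition. Scalars are real because an isometry that is a real scalar must be
  \<open>1\<close> or \<open>- 1\<close>.\<close>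

typedef 'x lop = "{F :: ('x \<Rightarrow> real) \<Rightarrow> 'x \<Rightarrow> real.
    \<forall>a b f g. F (\<lambda>w. a * f w + b * g w) = (\<lambda>w. a * F f w + b * F g w)}"
  by (rule exI[of _ "\<lambda>f. f"]) simp

setup_lifting type_definition_lop

lift_definition app :: "'x lop \<Rightarrow> ('x \<Rightarrow> real) \<Rightarrow> 'x \<Rightarrow> real" is "\<lambda>F. F" .

lemma app_linear: "app F (\<lambda>w. a * f w + b * g w) = (\<lambda>w. a * app F f w + b * app F g w)"
  by transfer simp

lemma app_add: "app F (\<lambda>w. f w + g w) = (\<lambda>w. app F f w + app F g w)"
  using app_linear[of F 1 f 1 g] by simp

lemma app_scale: "app F (\<lambda>w. a * f w) = (\<lambda>w. a * app F f w)"
  using app_linear[of F a f 0 f] by simp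

lemma lop_eqI: "(\<And>f w. app F f w = app G f w) \<Longrightarrow> F = G"
  by transfer (auto simp: fun_eq_iff)

instantiation lop :: (type) real_algebra_1
begin

lift_definition zero_lop :: "'a lop" is "\<lambda>f w. 0" by simp
lift_definition one_lop :: "'a lop" is "\<lambda>f. f" by simp
lift_definition plus_lop :: "'a lop \<Rightarrow> 'a lop \<Rightarrow> 'a lop" is "\<lambda>F G f w. F f w + G f w"
  by (simp add: algebra_simps)
lift_definition minus_lop :: "'a lop \<Rightarrow> 'a lop \<Rightarrow> 'a lop" is "\<lambda>F G f w. F f w - G f w"
  by (simp add: algebra_simps)
lift_definition uminus_lop :: "'a lop \<Rightarrow> 'a lop" is "\<lambda>F f w. - F f w"
  by (simp add: algebra_simps)
lift_definition times_lop :: "'a lop \<Rightarrow> 'a lop \<Rightarrow> 'a lop" is "\<lambda>F G f. F (G f)"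
  by simp
lift_definition scaleR_lop :: "real \<Rightarrow> 'a lop \<Rightarrow> 'a lop" is "\<lambda>c F f w. c * F f w"
  by (simp add: algebra_simps)

lemmas app_simps = zero_lop.rep_eq one_lop.rep_eq plus_lop.rep_eq minus_lop.rep_eq
  uminus_lop.rep_eq times_lop.rep_eq scaleR_lop.rep_eq

lemma app_ops [simp]:
  "app 0 f w = 0" "app 1 f = f" "app (F + G) f w = app F f w + app G f w"
  "app (F - G) f w = app F f w - app G f w" "app (- F) f w = - app F f w"
  "app (F * G) f = app F (app G f)" "app (c *\<^sub>R F) f w = c * app F f w"
  by (simp_all add: app.rep_eq app_simps)

lemma app_plus_fun: "app (F + G) f = (\<lambda>w. app F f w + app G f w)"
  by (simp add: fun_eq_iff)

lemma app_scaleR_fun: "app (c *\<^sub>R F) f = (\<lambda>w. c * app F f w)"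
  by (simp add: fun_eq_iff)

instance
proof
  fix F G H :: "'a lop" and a b :: real
  show "F * G * H = F * (G * H)" "F + G + H = F + (G + H)" "F + G = G + F" "0 + F = F"
    "- F + F = 0" "F - G = F + - G" "1 * F = F" "F * 1 = F" "(F + G) * H = F * H + G * H"
    "a *\<^sub>R (F + G) = a *\<^sub>R F + a *\<^sub>R G" "(a + b) *\<^sub>R F = a *\<^sub>R F + b *\<^sub>R F"
    "a *\<^sub>R b *\<^sub>R F = (a * b) *\<^sub>R F" "1 *\<^sub>R F = F" "a *\<^sub>R F * G = a *\<^sub>R (F * G)"
    by (rule lop_eqI; simp add: algebra_simps)+
  show "F * (G + H) = F * G + F * H"
    by (rule lop_eqI) (simp add: app_plus_fun app_add)
  show "F * a *\<^sub>R G = a *\<^sub>R (F * G)"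
    by (rule lop_eqI) (simp add: app_scaleR_fun app_scale)
  have "app (0 :: 'a lop) (\<lambda>w. 1) undefined \<noteq> app 1 (\<lambda>w. 1) undefined"
    by simp
  then show "(0 :: 'a lop) \<noteq> 1" by metis
qed

end

subsection \<open>Quaternion pairs\<close>

definition quaternion_pair :: "'a::ring_1 \<Rightarrow> 'a \<Rightarrow> bool" where
  "quaternion_pair u v \<longleftrightarrow> u * u = - 1 \<and> v * v = - 1 \<and> v * u = - (u * v)"

text \<open>The trailing factor \<open>x\<close> lets rewriting sort letters in the middle of a
  right-nested product.\<close>

lemma left_commuteI:
  fixes a b :: "'a::ring_1"
  shows "b * a = a * b \<Longrightarrow> b * (a * x) = a * (b * x)"
    "b * a = - (a * b) \<Longrightarrow> b * (a * x) = - (a * (b * x))"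
    "a * a = - 1 \<Longrightarrow> a * (a * x) = - x"
  by (simp_all flip: mult.assoc)

text \<open>With quaternion units for \<open>u\<close> and \<open>v\<close>, half of
  \<open>h\<close> is the unit quaternion \<open>(1 + i + j + k) / 2\<close> of order six. Working
  with its double keeps the identity meaningful in every ring.\<close>

lemma quaternion_square:
  fixes u v :: "'a::ring_1"
  assumes "quaternion_pair u v"
  defines "h \<equiv> (1 + u) * (1 + v)"
  shows "h * h = h + h - 4"
proof -
  have *: "u * u = - 1" "v * v = - 1" "v * u = - (u * v)"
    using assms by (auto simp: quaternion_pair_def)
  note ** = *(3)[THEN left_commuteI(2)] *(1,2)[THEN left_commuteI(3)]
  show ?thesis
    unfolding h_def by (simp add: * ** algebra_simps)
qed

lemma quaternion_braid:
  fixes u v u' v' :: "'a::ring_1"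
  assumes "quaternion_pair u v" "quaternion_pair u' v'"
    and "u' * u = u * u'" "v' * v = v * v'" "v' * u = - (u * v')" "v * u' = - (u' * v)"
  defines "h \<equiv> (1 + u) * (1 + v)" and "h' \<equiv> (1 + u') * (1 + v')"
  shows "h * h' * h = h' * h * h'"
proof -
  have *: "u * u = - 1" "v * v = - 1" "v * u = - (u * v)"
    "u' * u' = - 1" "v' * v' = - 1" "v' * u' = - (u' * v')"
    using assms(1,2) by (auto simp: quaternion_pair_def)
  note ** = *(3)[THEN left_commuteI(2)] *(6)[THEN left_commuteI(2)]
    assms(5,6)[THEN left_commuteI(2)] assms(3,4)[THEN left_commuteI(1)]
    *(1,2)[THEN left_commuteI(3)] *(4,5)[THEN left_commuteI(3)]
  show ?thesis
    unfolding h_def h'_def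
    by (simp add: * ** assms(3-6) algebra_simps)
qed

lemma quaternion_commute:
  fixes u v u' v' :: "'a::ring_1"
  assumes "u' * u = u * u'" "v' * v = v * v'" "v' * u = u * v'" "v * u' = u' * v"
  defines "h \<equiv> (1 + u) * (1 + v)" and "h' \<equiv> (1 + u') * (1 + v')"
  shows "h * h' = h' * h"
proof -
  note ** = assms(1-4)[THEN left_commuteI(1)]
  show ?thesis
    unfolding h_def h'_def
    by (simp add: ** assms(1-4) algebra_simps)
qed

text \<open>Moving \<open>e\<close> to the left turns \<open>h\<close> into
  \<open>(1 + s u) (1 + t v)\<close> with signs \<open>s\<close> and \<open>t\<close>. Each such
  product is \<open>m * h\<close> with \<open>m\<close> one of \<open>1\<close>, \<open>- u\<close>,
  \<open>v * u\<close>, \<open>- v\<close>, which gives the four candidates for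
  \<open>e'\<close>.\<close>

lemma quaternion_conjugate:
  fixes u v e :: "'a::ring_1"
  assumes "quaternion_pair u v"
    and eu: "e * u = u * e \<or> e * u = - (u * e)" and ev: "e * v = v * e \<or> e * v = - (v * e)"
  defines "h \<equiv> (1 + u) * (1 + v)"
  shows "\<exists>e'\<in>{e, - (e * u), e * v * u, - (e * v)}. h * e = e' * h"
proof -
  have *: "u * u = - 1" "v * v = - 1" "v * u = - (u * v)"
    using assms by (auto simp: quaternion_pair_def)
  note ** = *(3)[THEN left_commuteI(2)] *(1,2)[THEN left_commuteI(3)]
  note l = left_commuteI
  consider "e * u = u * e" "e * v = v * e" | "e * u = - (u * e)" "e * v = v * e"
    | "e * u = u * e" "e * v = - (v * e)" | "e * u = - (u * e)" "e * v = - (v * e)"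
    using eu ev by blast
  then show ?thesis
  proof cases
    case 1
    then have "h * e = e * h"
      unfolding h_def by (simp add: * ** 1[THEN l(1)] algebra_simps)
    then show ?thesis by blast
  next
    case 2
    then have "h * e = - (e * u) * h"
      unfolding h_def
      by (simp add: * ** 2(1)[THEN l(2)] 2(2)[THEN l(1)] algebra_simps)
    then show ?thesis by blast
  next
    case 3
    then have "h * e = (e * v * u) * h"
      unfolding h_def
      by (simp add: * ** 3(1)[THEN l(1)] 3(2)[THEN l(2)] algebra_simps)
    then show ?thesis by blast
  next
    case 4
    then have "h * e = - (e * v) * h"
      unfolding h_def
      by (simp add: * ** 4[THEN l(2)] algebra_simps)
    then show ?thesis by blast
  qed
qed

subsection \<open>A twisted group algebra in its left regular representation\<close>

definition symdiff :: "'a set \<Rightarrow> 'a set \<Rightarrow> 'a set" where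
  "symdiff S T = (S - T) \<union> (T - S)"

lemma symdiff_simps [simp]: "symdiff S S = {}" "symdiff S {} = S" "symdiff {} S = S" "symdiff S (symdiff S T) = T"
  by (auto simp: symdiff_def)

lemma symdiff_commute: "symdiff S T = symdiff T S"
  by (auto simp: symdiff_def)

lemma symdiff_eq_empty_iff [simp]: "symdiff S T = {} \<longleftrightarrow> S = T"
  by (auto simp: symdiff_def)

lemma symdiff_subset: "S \<subseteq> K \<Longrightarrow> T \<subseteq> K \<Longrightarrow> symdiff S T \<subseteq> K"
  by (auto simp: symdiff_def)

text \<open>A common element of \<open>S\<close> and \<open>T\<close> occurs twice on the right and
  squares to 1. This makes the sign cocycle multiplicative in each argument.\<close>

lemma prod_symdiff:
  fixes f :: "'a \<Rightarrow> real"
  assumes K: "finite K" and f: "\<And>s. f s * f s = 1"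
  shows "prod f (symdiff S T \<inter> K) = prod f (S \<inter> K) * prod f (T \<inter> K)"
proof -
  define A B where "A = S \<inter> K" and "B = T \<inter> K"
  have fin: "finite A" "finite B" using K by (auto simp: A_def B_def)
  have "symdiff S T \<inter> K = (A - B) \<union> (B - A)" by (auto simp: A_def B_def symdiff_def)
  then have "prod f (symdiff S T \<inter> K) = prod f (A - B) * prod f (B - A)"
    using fin by (simp add: prod.union_disjoint Diff_Int_distrib2 inf_commute disjoint_iff)
  moreover have "prod f A = prod f (A - B) * prod f (A \<inter> B)"
    using fin by (subst prod.union_disjoint[symmetric]) (auto intro: prod.cong)
  moreover have "prod f B = prod f (B - A) * prod f (A \<inter> B)"
    using fin by (subst prod.union_disjoint[symmetric]) (auto intro: prod.cong)
  moreover have "prod f (A \<inter> B) * prod f (A \<inter> B) = 1"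
    using f by (simp flip: prod.distrib)
  ultimately show ?thesis
    unfolding A_def[symmetric] B_def[symmetric]
    by (simp add: mult.assoc mult.left_commute[of _ "prod f (A \<inter> B)"])
qed

text \<open>\<open>(i, False)\<close> and \<open>(i, True)\<close> index the generators \<open>u\<^sub>i\<close> and \<open>v\<^sub>i\<close>
  of Goldschmidt and Jones.\<close>

type_synonym gj_index = "nat \<times> bool"

text \<open>The sign created by putting the product of \<open>s\<close> and \<open>t\<close> into
  the order with all \<open>u\<close> before all \<open>v\<close>: \<open>- 1\<close> for a square
  and for a \<open>v\<close> standing left of an anticommuting \<open>u\<close>.\<close>

definition gen_sign :: "gj_index \<Rightarrow> gj_index \<Rightarrow> real" where
  "gen_sign = (\<lambda>(i, a) (j, b).
     if i = j \<and> a = b \<or> a \<and> \<not> b \<and> i \<le> Suc j \<and> j \<le> Suc i then - 1 else 1)"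

text \<open>Braid letters have indices \<open>1\<close> to \<open>n - 1\<close>; the pair with index
  \<open>n\<close> is the additional one that detects centralizing elements.\<close>

definition indices :: "nat \<Rightarrow> gj_index set" where
  "indices n = {..n} \<times> UNIV"

text \<open>The sign of a product of two monomials. Intersecting with \<open>indices n\<close> keeps
  the product finite for arbitrary sets, since the operators act on functions of all of
  them.\<close>

definition cocycle :: "nat \<Rightarrow> gj_index set \<Rightarrow> gj_index set \<Rightarrow> real" where
  "cocycle n S T = (\<Prod>s\<in>S \<inter> indices n. \<Prod>t\<in>T \<inter> indices n. gen_sign s t)"

lemma finite_indices [simp]: "finite (indices n)"
  by (simp add: indices_def)

lemma gen_sign_square [simp]: "gen_sign s t * gen_sign s t = 1"
  by (simp add: gen_sign_def split: prod.split)

lemma prod_square_one: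
  fixes f :: "'a \<Rightarrow> real"
  shows "(\<And>s. f s * f s = 1) \<Longrightarrow> prod f A * prod f A = 1"
  by (simp flip: prod.distrib)

lemma cocycle_square [simp]: "cocycle n S T * cocycle n S T = 1"
  unfolding cocycle_def by (intro prod_square_one gen_sign_square)

lemma cocycle_cases: "cocycle n S T = 1 \<or> cocycle n S T = - 1"
  using cocycle_square[of n S T] by (simp only: square_eq_1_iff)

lemma cocycle_symdiff_left: "cocycle n (symdiff S S') T = cocycle n S T * cocycle n S' T"
  unfolding cocycle_def by (intro prod_symdiff prod_square_one gen_sign_square finite_indices)

lemma cocycle_symdiff_right: "cocycle n S (symdiff T T') = cocycle n S T * cocycle n S T'"
  unfolding cocycle_def by (simp add: prod_symdiff flip: prod.distrib)

lemma cocycle_empty [simp]: "cocycle n {} S = 1" "cocycle n S {} = 1"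
  by (simp_all add: cocycle_def)

lemma cocycle_singleton:
  "s \<in> indices n \<Longrightarrow> t \<in> indices n \<Longrightarrow> cocycle n {s} {t} = gen_sign s t"
  by (simp add: cocycle_def)

text \<open>Left multiplication by the monomial with letters \<open>S\<close>: the coefficient at
  \<open>w\<close> comes from the monomial \<open>symdiff S w\<close>, with the sign of that
  product.\<close>

lift_definition basis_op :: "nat \<Rightarrow> gj_index set \<Rightarrow> gj_index set lop" is
  "\<lambda>n S f w. cocycle n S (symdiff S w) * f (symdiff S w)"
  by (simp add: algebra_simps)

lemma app_basis_op [simp]: "app (basis_op n S) f w = cocycle n S (symdiff S w) * f (symdiff S w)"
  by (simp add: app.rep_eq basis_op.rep_eq)

lemma basis_op_empty [simp]: "basis_op n {} = 1"
  by (rule lop_eqI) simp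

lemma basis_op_mult: "basis_op n S * basis_op n T = cocycle n S T *\<^sub>R basis_op n (symdiff S T)"
proof (rule lop_eqI)
  fix f w
  define r where "r = symdiff S (symdiff T w)"
  have "symdiff S w = symdiff T r" "symdiff (symdiff S T) w = r" "symdiff T (symdiff S w) = r"
    unfolding r_def by (auto simp: symdiff_def)
  moreover have "cocycle n S T * cocycle n S T * x = x" for x by simp
  ultimately show "app (basis_op n S * basis_op n T) f w = app (cocycle n S T *\<^sub>R basis_op n (symdiff S T)) f w"
    by (simp add: cocycle_symdiff_left cocycle_symdiff_right flip: mult.assoc)
qed

section \<open>Spans of monomials, coefficients and the canonical trace\<close>

definition subalg :: "nat \<Rightarrow> gj_index set \<Rightarrow> gj_index set lop set" where
  "subalg n J = span (basis_op n ` Pow J)"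

text \<open>Applying a left multiplication to the vector of the empty monomial recovers the element
  itself, so for \<open>X\<close> in the span this is the coefficient of
  \<open>basis_op n S\<close>. The case \<open>S = {}\<close> is the canonical trace.\<close>

definition coef :: "gj_index set lop \<Rightarrow> gj_index set \<Rightarrow> real" where
  "coef X S = app X (\<lambda>w. if w = {} then 1 else 0) S"

lemma coef_simps [simp]:
  "coef 0 S = 0" "coef (X + Y) S = coef X S + coef Y S" "coef (X - Y) S = coef X S - coef Y S"
  "coef (- X) S = - coef X S" "coef (c *\<^sub>R X) S = c * coef X S"
  by (simp_all add: coef_def)

lemma coef_basis_op: "coef (basis_op n S) T = (if S = T then 1 else 0)"
  by (auto simp: coef_def)

lemma coef_one: "coef 1 T = (if T = {} then 1 else 0)"
  by (simp add: coef_def)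

lemma subalg_base: "S \<subseteq> J \<Longrightarrow> basis_op n S \<in> subalg n J"
  unfolding subalg_def by (auto intro: real_vector.span_base)

lemma subalg_closed:
  "1 \<in> subalg n J"
  "X \<in> subalg n J \<Longrightarrow> Y \<in> subalg n J \<Longrightarrow> X + Y \<in> subalg n J"
  "X \<in> subalg n J \<Longrightarrow> Y \<in> subalg n J \<Longrightarrow> X - Y \<in> subalg n J"
  "X \<in> subalg n J \<Longrightarrow> c *\<^sub>R X \<in> subalg n J"
  using subalg_base[of "{}" J n]
  by (auto simp: subalg_def real_vector.span_add real_vector.span_diff real_vector.span_scale)

lemma subalg_induct [consumes 1, case_names zero add scale basis_op]:
  assumes "X \<in> subalg n J" "P 0"
    "\<And>X Y. P X \<Longrightarrow> P Y \<Longrightarrow> P (X + Y)" "\<And>c X. P X \<Longrightarrow> P (c *\<^sub>R X)"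
    "\<And>S. S \<subseteq> J \<Longrightarrow> P (basis_op n S)"
  shows "P X"
  using assms(1) unfolding subalg_def
  by (rule real_vector.span_induct) (auto simp: real_vector.subspace_def assms)

lemma subalg_mult:
  assumes "X \<in> subalg n J" "Y \<in> subalg n J"
  shows "X * Y \<in> subalg n J"
  using assms(1)
proof (induction rule: subalg_induct)
  case (basis_op S)
  show ?case using assms(2)
  proof (induction rule: subalg_induct)
    case (basis_op T)
    then show ?case
      using \<open>S \<subseteq> J\<close> by (simp add: basis_op_mult subalg_closed subalg_base symdiff_subset)
  qed (use subalg_closed(4)[OF subalg_closed(1), of 0 n J] in
      \<open>simp_all add: distrib_left subalg_closed\<close>)
qed (use subalg_closed(4)[OF subalg_closed(1), of 0 n J] in
    \<open>simp_all add: distrib_right subalg_closed\<close>)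

lemma subalg_expand:
  assumes "X \<in> subalg n J" "finite J"
  shows "X = (\<Sum>S\<in>Pow J. coef X S *\<^sub>R basis_op n S)"
  using assms(1)
proof (induction rule: subalg_induct)
  case (basis_op T)
  have "(\<Sum>S\<in>Pow J. coef (basis_op n T) S *\<^sub>R basis_op n S) = (\<Sum>S\<in>Pow J. if T = S then basis_op n S else 0)"
    by (intro sum.cong) (simp_all add: coef_basis_op)
  then show ?case using basis_op assms(2) by simp
next
  case (scale c X)
  have "(\<Sum>S\<in>Pow J. coef (c *\<^sub>R X) S *\<^sub>R basis_op n S) =
      c *\<^sub>R (\<Sum>S\<in>Pow J. coef X S *\<^sub>R basis_op n S)"
    by (simp add: scaleR_sum_right)
  then show ?case using scale by simp
qed (simp_all add: scaleR_add_left sum.distrib)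

text \<open>On monomials \<open>S\<close> and \<open>T\<close> both sides vanish unless
  \<open>S = T\<close>, and then they coincide.\<close>

lemma trace_mult_commute:
  assumes "X \<in> subalg n J" "Y \<in> subalg n J"
  shows "coef (X * Y) {} = coef (Y * X) {}"
  using assms(1)
proof (induction rule: subalg_induct)
  case (basis_op S)
  show ?case using assms(2)
    by (induction rule: subalg_induct) (auto simp: basis_op_mult coef_basis_op algebra_simps)
qed (simp_all add: algebra_simps)

text \<open>A monomial inside \<open>J\<close> cannot cancel \<open>T\<close>, so nothing
  contributes to the empty monomial. The Markov property rests on this.\<close>

lemma trace_mult_basis_op:
  assumes "X \<in> subalg n J" "\<not> T \<subseteq> J"
  shows "coef (X * basis_op n T) {} = 0"
  using assms(1)
proof (induction rule: subalg_induct)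
  case (basis_op S)
  then have "S \<noteq> T" using assms(2) by auto
  then show ?case by (simp add: basis_op_mult coef_basis_op)
qed (simp_all add: algebra_simps)

lemma coef_mult_basis_op:
  assumes "X \<in> subalg n J"
  shows "coef (X * basis_op n T) (symdiff S T) = cocycle n S T * coef X S"
  using assms
proof (induction rule: subalg_induct)
  case (basis_op R)
  have "symdiff R T = symdiff S T \<longleftrightarrow> R = S" by (metis symdiff_commute symdiff_simps(4))
  then show ?case by (simp add: basis_op_mult coef_basis_op)
qed (simp_all add: algebra_simps)

lemma coef_basis_op_mult: "coef (basis_op n T * X) (symdiff S T) = cocycle n T S * coef X S"
  by (simp add: coef_def symdiff_commute[of S T])

text \<open>Take the largest index \<open>m\<close> of a letter of some kind \<open>b\<close> in
  \<open>S\<close>, and let \<open>t\<close> have index \<open>m + 1\<close> and the other kind. It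
  anticommutes with that letter and commutes with all others in \<open>S\<close>, hence anticommutes
  with the monomial. The index \<open>m + 1\<close> is the reason for \<open>Suc n\<close>.\<close>

lemma cocycle_antisymmetric_witness:
  assumes "S \<subseteq> indices n" "S \<noteq> {}"
  obtains t where "t \<in> indices (Suc n)" "cocycle (Suc n) S {t} \<noteq> cocycle (Suc n) {t} S"
proof -
  obtain i b where ib: "(i, b) \<in> S" using assms(2) by auto
  have fin: "finite {i. (i, b) \<in> S}"
    by (rule finite_subset[of _ "{..n}"]) (use assms(1) in \<open>auto simp: indices_def\<close>)
  define m where "m = Max {i. (i, b) \<in> S}"
  have mS: "(m, b) \<in> S" and mx: "\<And>i. (i, b) \<in> S \<Longrightarrow> i \<le> m"
    using Max_in[OF fin] Max_ge[OF fin] ib by (auto simp: m_def)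
  define t where "t = (Suc m, \<not> b)"
  have t: "t \<in> indices (Suc n)" using mS assms(1) by (auto simp: t_def indices_def)
  have S: "S \<inter> indices (Suc n) = S" using assms(1) by (auto simp: indices_def)
  have finS: "finite S" using assms(1) finite_indices finite_subset by blast
  have *: "gen_sign s t * gen_sign t s = (if s = (m, b) then - 1 else 1)" if "s \<in> S" for s
    using that mx[of "fst s"] unfolding t_def gen_sign_def
    by (cases s; cases b; cases "snd s") auto
  have "cocycle (Suc n) S {t} * cocycle (Suc n) {t} S = (\<Prod>s\<in>S. gen_sign s t * gen_sign t s)"
    using t S by (simp add: cocycle_def prod.distrib)
  also have "\<dots> = (\<Prod>s\<in>S. if s = (m, b) then - 1 else 1)"
    using * by (intro prod.cong) auto
  also have "\<dots> = - 1" using mS finS by simp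
  finally have "cocycle (Suc n) S {t} \<noteq> cocycle (Suc n) {t} S"
    by (metis cocycle_square one_neq_neg_one)
  with t show ?thesis using that by blast
qed

text \<open>Comparing coefficients on both sides of the commutation kills the coefficient of every
  monomial that anticommutes with some generator, and each nonempty one does.\<close>

lemma centralizer_scalar:
  assumes X: "X \<in> subalg (Suc n) (indices n)"
    and comm: "\<And>t. t \<in> indices (Suc n) \<Longrightarrow> X * basis_op (Suc n) {t} = basis_op (Suc n) {t} * X"
  shows "X = coef X {} *\<^sub>R 1"
proof -
  have 0: "coef X S = 0" if S: "S \<subseteq> indices n" "S \<noteq> {}" for S
  proof -
    obtain t where t: "t \<in> indices (Suc n)"
      and ne: "cocycle (Suc n) S {t} \<noteq> cocycle (Suc n) {t} S"
      using cocycle_antisymmetric_witness[OF S] by blast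
    have "cocycle (Suc n) S {t} * coef X S = cocycle (Suc n) {t} S * coef X S"
      using coef_mult_basis_op[OF X, of "{t}" S] coef_basis_op_mult[of "Suc n" "{t}" X S] comm[OF t]
      by metis
    then show ?thesis using ne by simp
  qed
  have "X = (\<Sum>S\<in>Pow (indices n). coef X S *\<^sub>R basis_op (Suc n) S)"
    by (rule subalg_expand[OF X]) simp
  also have "\<dots> = (\<Sum>S\<in>Pow (indices n). if S = {} then coef X {} *\<^sub>R 1 else 0)"
    using 0 by (intro sum.cong) auto
  also have "\<dots> = coef X {} *\<^sub>R 1" by simp
  finally show ?thesis .
qed

subsection \<open>Orthogonality\<close>

text \<open>The coordinates are restricted to a finite set, which monomials over
  \<open>indices n\<close> permute up to sign.\<close>

definition form :: "nat \<Rightarrow> (gj_index set \<Rightarrow> real) \<Rightarrow> (gj_index set \<Rightarrow> real) \<Rightarrow> real" where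
  "form n f g = (\<Sum>w\<in>Pow (indices n). f w * g w)"

lemma form_basis_op:
  assumes "S \<subseteq> indices n"
  shows "form n (app (basis_op n S) f) (app (basis_op n S) g) = form n f g"
proof -
  have "form n (app (basis_op n S) f) (app (basis_op n S) g) =
      (\<Sum>w\<in>Pow (indices n). f (symdiff S w) * g (symdiff S w))"
    unfolding form_def
  proof (intro sum.cong refl)
    fix w
    have "cocycle n S (symdiff S w) * f (symdiff S w) * (cocycle n S (symdiff S w) * g (symdiff S w)) =
      (cocycle n S (symdiff S w) * cocycle n S (symdiff S w)) * (f (symdiff S w) * g (symdiff S w))"
      by (simp only: mult.assoc mult.left_commute)
    then show "app (basis_op n S) f w * app (basis_op n S) g w = f (symdiff S w) * g (symdiff S w)"
      by simp
  qed
  also have "\<dots> = form n f g"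
    unfolding form_def
    by (rule sum.reindex_bij_witness[where i = "symdiff S" and j = "symdiff S"])
       (simp_all add: assms symdiff_subset)
  finally show ?thesis .
qed

text \<open>A form-preserving \<open>B\<close> with square \<open>- 1\<close> sends \<open>f\<close>
  to a vector orthogonal to \<open>f\<close>, because applying \<open>B\<close> to both changes the
  sign of their product. So the cross terms vanish and two equal squares remain.\<close>

lemma form_one_plus_basis_op:
  assumes S: "S \<subseteq> indices n" and sq: "basis_op n S * basis_op n S = - 1"
  shows "form n (app (1 + basis_op n S) f) (app (1 + basis_op n S) f) = 2 * form n f f"
proof -
  define g where "g = app (basis_op n S) f"
  have gg: "app (basis_op n S) g = (\<lambda>w. - f w)"
    using arg_cong[OF sq, of "\<lambda>X. app X f"] unfolding g_def app_ops(6)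
    by (simp only: app_ops fun_eq_iff simp_thms)
  have "form n f g = form n (app (basis_op n S) f) (app (basis_op n S) g)"
    using form_basis_op[OF S] by simp
  also have "\<dots> = - form n f g"
    unfolding gg g_def[symmetric] by (simp add: form_def sum_negf mult.commute)
  finally have 0: "form n f g = 0" by simp
  have "app (1 + basis_op n S) f = (\<lambda>w. f w + g w)"
    by (simp add: app_plus_fun g_def)
  then have "form n (app (1 + basis_op n S) f) (app (1 + basis_op n S) f) =
      form n f f + 2 * form n f g + form n g g"
    by (simp add: form_def algebra_simps sum.distrib sum_distrib_left)
  then show ?thesis using 0 form_basis_op[OF S, of f f] by (simp add: g_def)
qed

subsection \<open>The quaternionic braid elements\<close>

definition gj_u :: "nat \<Rightarrow> nat \<Rightarrow> gj_index set lop" where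
  "gj_u n i = basis_op n {(i, False)}"

definition gj_v :: "nat \<Rightarrow> nat \<Rightarrow> gj_index set lop" where
  "gj_v n i = basis_op n {(i, True)}"

definition gj_braid :: "nat \<Rightarrow> nat \<Rightarrow> gj_index set lop" where
  "gj_braid n i = (1 / 2) *\<^sub>R ((1 + gj_u n i) * (1 + gj_v n i))"

lemma basis_op_generators:
  "s \<in> indices n \<Longrightarrow> t \<in> indices n \<Longrightarrow>
    basis_op n {s} * basis_op n {t} = gen_sign s t *\<^sub>R basis_op n (symdiff {s} {t})"
  by (simp add: basis_op_mult cocycle_singleton)

lemma basis_op_commute:
  "basis_op n S * basis_op n T = basis_op n T * basis_op n S \<or>
   basis_op n S * basis_op n T = - (basis_op n T * basis_op n S)"
  using cocycle_cases[of n S T] cocycle_cases[of n T S]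
  by (auto simp: basis_op_mult symdiff_commute)

lemma mem_indices: "i \<le> n \<Longrightarrow> (i, b) \<in> indices n"
  by (simp add: indices_def)

lemma gj_quaternion_pair: "i \<le> n \<Longrightarrow> quaternion_pair (gj_u n i) (gj_v n i)"
  unfolding quaternion_pair_def gj_u_def gj_v_def
  by (simp add: basis_op_generators mem_indices gen_sign_def symdiff_commute)

lemma gj_commute:
  assumes "i \<le> n" "j \<le> n"
  shows "gj_u n i * gj_u n j = gj_u n j * gj_u n i" "gj_v n i * gj_v n j = gj_v n j * gj_v n i"
    "gj_v n i * gj_u n j = (if i \<le> Suc j \<and> j \<le> Suc i then - (gj_u n j * gj_v n i)
      else gj_u n j * gj_v n i)"
  using assms unfolding gj_u_def gj_v_def
  by (auto simp add: basis_op_generators mem_indices gen_sign_def symdiff_commute)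

lemma gj_braid_square:
  assumes "i \<le> n"
  shows "gj_braid n i * gj_braid n i = gj_braid n i - 1"
proof -
  define h where "h = (1 + gj_u n i) * (1 + gj_v n i)"
  have "h * h = h + h - 4"
    using quaternion_square[OF gj_quaternion_pair[OF assms]] by (simp add: h_def)
  also have "\<dots> = 2 *\<^sub>R h - 4 *\<^sub>R 1"
    by (simp add: scaleR_2 scaleR_conv_of_real[of 4])
  finally show ?thesis
    by (simp add: gj_braid_def h_def[symmetric] scaleR_diff_right)
qed

lemma gj_braid_braid:
  assumes "Suc i \<le> n"
  shows "gj_braid n i * gj_braid n (Suc i) * gj_braid n i =
    gj_braid n (Suc i) * gj_braid n i * gj_braid n (Suc i)"
  using quaternion_braid[OF gj_quaternion_pair gj_quaternion_pair, of i n "Suc i" n] assms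
  by (simp add: gj_braid_def gj_commute)

lemma gj_braid_commute:
  assumes "i \<le> n" "j \<le> n" "Suc i < j"
  shows "gj_braid n i * gj_braid n j = gj_braid n j * gj_braid n i"
  using quaternion_commute[of "gj_u n j" "gj_u n i" "gj_v n j" "gj_v n i"] assms
  by (simp add: gj_braid_def gj_commute)

text \<open>All three follow from \<open>h * h = h - 1\<close>. The last one expresses the inverse
  through \<open>h\<close>, so properties stable under products and signs pass to it.\<close>

lemma gj_braid_inverse:
  assumes "i \<le> n"
  shows "gj_braid n i * (1 - gj_braid n i) = 1" "(1 - gj_braid n i) * gj_braid n i = 1"
    "1 - gj_braid n i = - (gj_braid n i * gj_braid n i)"
  by (simp_all add: gj_braid_square[OF assms] algebra_simps)

lemma gj_braid_subalg: "{i} \<times> UNIV \<subseteq> J \<Longrightarrow> gj_braid n i \<in> subalg n J"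
  unfolding gj_braid_def gj_u_def gj_v_def
  by (intro subalg_closed subalg_mult subalg_base) auto

text \<open>Expanding \<open>gj_braid\<close> gives \<open>X / 2\<close> and three terms in which
  \<open>X\<close> meets a monomial outside \<open>J\<close>; these have trace zero.\<close>

lemma trace_gj_braid:
  assumes X: "X \<in> subalg n J" and i: "i \<le> n" "(i, False) \<notin> J" "(i, True) \<notin> J"
  shows "coef (X * gj_braid n i) {} = coef X {} / 2"
proof -
  have "gj_u n i * gj_v n i = basis_op n {(i, False), (i, True)}"
    using i by (simp add: gj_u_def gj_v_def basis_op_generators mem_indices gen_sign_def)
      (simp add: symdiff_def insert_commute)
  then have "X * gj_braid n i = (1 / 2) *\<^sub>R (X + X * basis_op n {(i, False)} +
      X * basis_op n {(i, True)} + X * basis_op n {(i, False), (i, True)})"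
    by (simp add: gj_braid_def algebra_simps gj_u_def gj_v_def)
  then show ?thesis
    using i by (simp add: trace_mult_basis_op[OF X])
qed

subsection \<open>Finiteness of the quaternionic image\<close>

definition signed_basis :: "nat \<Rightarrow> gj_index set lop set" where
  "signed_basis n = basis_op n ` Pow (indices n) \<union> uminus ` basis_op n ` Pow (indices n)"

lemma finite_signed_basis: "finite (signed_basis n)"
  by (simp add: signed_basis_def)

lemma signed_basis_uminus: "X \<in> signed_basis n \<Longrightarrow> - X \<in> signed_basis n"
  by (auto simp: signed_basis_def)

lemma basis_op_signed_basis: "S \<subseteq> indices n \<Longrightarrow> basis_op n S \<in> signed_basis n"
  by (auto simp: signed_basis_def)

lemma signed_basis_mult:
  assumes "X \<in> signed_basis n" "Y \<in> signed_basis n"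
  shows "X * Y \<in> signed_basis n"
proof -
  have *: "basis_op n S * basis_op n T \<in> signed_basis n" if "S \<subseteq> indices n" "T \<subseteq> indices n" for S T
    using cocycle_cases[of n S T] symdiff_subset[OF that]
    by (auto simp: basis_op_mult intro!: signed_basis_uminus[of "basis_op n _"] basis_op_signed_basis)
  show ?thesis
    using assms(1)[unfolded signed_basis_def] assms(2)[unfolded signed_basis_def]
    by (auto intro!: * signed_basis_uminus)
qed

text \<open>Conjugation of signed monomials is phrased as \<open>X * e = e' * X\<close> to avoid
  inverses. \<open>X\<close> uses indices up to \<open>n - 1\<close> while the monomials range up to
  \<open>n\<close>, as \<open>centralizer_scalar\<close> demands.\<close>

definition clifford :: "nat \<Rightarrow> gj_index set lop \<Rightarrow> bool" where
  "clifford n X \<longleftrightarrow> X \<in> subalg n (indices (n - 1)) \<and>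
     (\<forall>e\<in>signed_basis n. \<exists>e'\<in>signed_basis n. X * e = e' * X) \<and>
     (\<forall>f. form n (app X f) (app X f) = form n f f)"

lemma clifford_mult:
  assumes "clifford n X" "clifford n Y"
  shows "clifford n (X * Y)"
proof -
  have "\<exists>e'\<in>signed_basis n. X * Y * e = e' * (X * Y)" if "e \<in> signed_basis n" for e
  proof -
    obtain e' where e': "e' \<in> signed_basis n" "Y * e = e' * Y"
      using assms(2) \<open>e \<in> signed_basis n\<close> unfolding clifford_def by blast
    obtain e'' where e'': "e'' \<in> signed_basis n" "X * e' = e'' * X"
      using assms(1) e'(1) unfolding clifford_def by blast
    have "X * Y * e = e'' * (X * Y)" using e' e'' by (metis mult.assoc)
    with e'' show ?thesis by blast
  qed
  then show ?thesis
    using assms by (simp add: clifford_def subalg_mult)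
qed

lemma clifford_one: "clifford n 1"
  by (auto simp: clifford_def subalg_closed)

lemma clifford_uminus: "clifford n X \<Longrightarrow> clifford n (- X)"
  using subalg_closed(4)[of X n "indices (n - 1)" "- 1"]
  by (simp add: clifford_def form_def)

lemma clifford_gj_braid:
  assumes i: "i < n"
  shows "clifford n (gj_braid n i)"
  unfolding clifford_def
proof (intro conjI ballI allI)
  let ?h = "(1 + gj_u n i) * (1 + gj_v n i)"
  have q: "quaternion_pair (gj_u n i) (gj_v n i)" using gj_quaternion_pair i by simp
  have sub: "{(i, False)} \<subseteq> indices n" "{(i, True)} \<subseteq> indices n"
    using i by (auto simp: indices_def)
  have uv: "gj_u n i \<in> signed_basis n" "gj_v n i \<in> signed_basis n"
    using sub by (auto simp: gj_u_def gj_v_def intro: basis_op_signed_basis)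
  show "gj_braid n i \<in> subalg n (indices (n - 1))"
    using i by (intro gj_braid_subalg) (auto simp: indices_def)
  have *: "\<exists>e'\<in>signed_basis n. gj_braid n i * e = e' * gj_braid n i"
    if e: "e = basis_op n S" "S \<subseteq> indices n" for e S
  proof -
    have "\<exists>e'\<in>{e, - (e * gj_u n i), e * gj_v n i * gj_u n i, - (e * gj_v n i)}. ?h * e = e' * ?h"
      unfolding e(1) by (rule quaternion_conjugate[OF q])
        (simp_all add: gj_u_def gj_v_def basis_op_commute)
    moreover have "e \<in> signed_basis n" using e basis_op_signed_basis by simp
    then have "{e, - (e * gj_u n i), e * gj_v n i * gj_u n i, - (e * gj_v n i)} \<subseteq> signed_basis n"
      using uv by (auto intro!: signed_basis_mult signed_basis_uminus)
    ultimately obtain e' where "e' \<in> signed_basis n" "?h * e = e' * ?h" by blast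
    then show ?thesis unfolding gj_braid_def by (intro bexI[of _ e']) simp_all
  qed
  show "\<exists>e'\<in>signed_basis n. gj_braid n i * e = e' * gj_braid n i" if e: "e \<in> signed_basis n" for e
  proof -
    obtain S where S: "S \<subseteq> indices n" "e = basis_op n S \<or> e = - basis_op n S"
      using e by (auto simp: signed_basis_def)
    obtain e' where "e' \<in> signed_basis n" "gj_braid n i * basis_op n S = e' * gj_braid n i"
      using *[OF refl S(1)] by blast
    then show ?thesis
      using S(2) signed_basis_uminus by (metis mult_minus_left mult_minus_right)
  qed
  show "form n (app (gj_braid n i) f) (app (gj_braid n i) f) = form n f f" for f
  proof -
    have sq: "basis_op n {(i, b)} * basis_op n {(i, b)} = - 1" for b
      using q by (cases b) (auto simp: quaternion_pair_def gj_u_def gj_v_def)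
    define g where "g = app (1 + gj_u n i) (app (1 + gj_v n i) f)"
    \<comment> \<open>Each of the two factors \<open>1 + basis_op\<close> doubles the form; the
      scalar \<open>1 / 2\<close> of \<open>gj_braid\<close> enters squared and compensates.\<close>
    have g: "form n g g = 4 * form n f f"
      unfolding g_def gj_u_def gj_v_def
      by (simp only: form_one_plus_basis_op[OF sub(1) sq] form_one_plus_basis_op[OF sub(2) sq])
    have "app (gj_braid n i) f = (\<lambda>w. (1 / 2) * g w)"
      unfolding gj_braid_def g_def by (simp only: app_scaleR_fun app_ops(6))
    then have "form n (app (gj_braid n i) f) (app (gj_braid n i) f) = (1 / 4) * form n g g"
      by (simp add: form_def sum_distrib_left)
    then show ?thesis using g by simp
  qed
qed

text \<open>The inverse has to be Clifford as well, so that the quotient of two units is again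
  Clifford.\<close>

definition clifford_units :: "nat \<Rightarrow> gj_index set lop set" where
  "clifford_units n = {X. clifford n X \<and> (\<exists>Y. clifford n Y \<and> X * Y = 1 \<and> Y * X = 1)}"

lemma clifford_units_mult:
  assumes "X \<in> clifford_units n" "X' \<in> clifford_units n"
  shows "X * X' \<in> clifford_units n"
proof -
  obtain Y Y' where Y: "clifford n Y" "X * Y = 1" "Y * X = 1" "clifford n Y'" "X' * Y' = 1" "Y' * X' = 1"
    using assms by (auto simp: clifford_units_def)
  have "X * X' * (Y' * Y) = X * (X' * Y') * Y" "Y' * Y * (X * X') = Y' * (Y * X) * X'"
    by (simp_all only: mult.assoc)
  then have "X * X' * (Y' * Y) = 1" "Y' * Y * (X * X') = 1"
    using Y by simp_all
  then show ?thesis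
    using assms Y clifford_mult unfolding clifford_units_def by blast
qed

lemma clifford_units_gj_braid:
  assumes "i < n"
  shows "gj_braid n i \<in> clifford_units n" "1 - gj_braid n i \<in> clifford_units n"
proof -
  have i: "i \<le> n" using assms by simp
  have "clifford n (1 - gj_braid n i)"
    unfolding gj_braid_inverse(3)[OF i]
    using assms by (intro clifford_uminus clifford_mult clifford_gj_braid)
  then show "gj_braid n i \<in> clifford_units n" "1 - gj_braid n i \<in> clifford_units n"
    using clifford_gj_braid[OF assms] gj_braid_inverse(1,2)[OF i]
    unfolding clifford_units_def by blast+
qed

text \<open>Two units inducing the same conjugation differ by a real scalar, which has absolute value 1
  because both are isometries.\<close>

lemma clifford_units_eq_up_to_sign:
  assumes n: "n \<ge> 1" and X: "X \<in> clifford_units n" and X': "X' \<in> clifford_units n"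
    and conj: "\<And>t. t \<in> indices n \<Longrightarrow>
      \<exists>e. X * basis_op n {t} = e * X \<and> X' * basis_op n {t} = e * X'"
  shows "X' = X \<or> X' = - X"
proof -
  obtain Y where Y: "clifford n Y" "X * Y = 1" "Y * X = 1"
    using X by (auto simp: clifford_units_def)
  \<comment> \<open>The quotient of the two units: equal conjugations make it commute with every
    generator, hence a scalar.\<close>
  define W where "W = Y * X'"
  have W: "clifford n W" using Y X' by (simp add: W_def clifford_mult clifford_units_def)
  have comm: "W * basis_op n {t} = basis_op n {t} * W" if t: "t \<in> indices n" for t
  proof -
    obtain e where e: "X * basis_op n {t} = e * X" "X' * basis_op n {t} = e * X'"
      using conj[OF t] by blast
    have "W * basis_op n {t} = Y * e * (X * Y) * X'"
      using e(2) Y(2) by (simp add: W_def mult.assoc)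
    also have "\<dots> = Y * (e * X) * Y * X'" by (simp only: mult.assoc)
    also have "\<dots> = (Y * X) * basis_op n {t} * (Y * X')"
      by (simp only: e(1)[symmetric] mult.assoc)
    finally show ?thesis by (simp add: Y W_def)
  qed
  obtain k where k: "n = Suc k" using n by (cases n) auto
  define c where "c = coef W {}"
  have Wc: "W = c *\<^sub>R 1"
    unfolding c_def
    using W comm centralizer_scalar[of W k] by (simp add: clifford_def k)
  \<comment> \<open>A test vector of square length 1, on which the isometry \<open>W\<close> forces
    \<open>c * c = 1\<close>.\<close>
  define f :: "gj_index set \<Rightarrow> real" where "f = (\<lambda>w. if w = {} then 1 else 0)"
  have ff: "form n f f = 1"
  proof -
    have "form n f f = (\<Sum>w\<in>Pow (indices n). if w = {} then 1 else 0)"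
      unfolding form_def f_def by (intro sum.cong) auto
    then show ?thesis by simp
  qed
  have "form n (app W f) (app W f) = c * c * form n f f"
    by (simp add: Wc app_scaleR_fun form_def sum_distrib_left mult_ac)
  then have "c * c = 1" using W ff by (simp add: clifford_def)
  then have "c = 1 \<or> c = - 1" by (simp only: square_eq_1_iff)
  moreover have "X' = X * W" using Y by (simp add: W_def flip: mult.assoc)
  ultimately show ?thesis by (auto simp: Wc)
qed

text \<open>Pigeonhole: the conjugation action on generators has finitely many possible values, and
  units with the same action agree up to sign.\<close>

lemma finite_clifford_units:
  assumes "n \<ge> 1"
  shows "finite (clifford_units n)"
proof (rule ccontr)
  assume inf: "infinite (clifford_units n)"
  \<comment> \<open>The restricted abstraction places \<open>conj X\<close> in the extensional
    function space over \<open>indices n\<close>, which is finite.\<close>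
  define conj where "conj = (\<lambda>X. \<lambda>t\<in>indices n.
    SOME e. e \<in> signed_basis n \<and> X * basis_op n {t} = e * X)"
  have conj: "conj X t \<in> signed_basis n \<and> X * basis_op n {t} = conj X t * X"
    if "X \<in> clifford_units n" "t \<in> indices n" for X t
  proof -
    have "\<exists>e. e \<in> signed_basis n \<and> X * basis_op n {t} = e * X"
      using that basis_op_signed_basis[of "{t}" n]
      unfolding clifford_units_def clifford_def by blast
    from someI_ex[OF this] show ?thesis using that(2) by (simp add: conj_def)
  qed
  have "conj ` clifford_units n \<subseteq> indices n \<rightarrow>\<^sub>E signed_basis n"
    using conj by (auto simp: PiE_iff) (simp add: conj_def)
  then have "finite (conj ` clifford_units n)"
    by (rule finite_subset) (simp add: finite_PiE finite_signed_basis)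
  then obtain X where X: "X \<in> clifford_units n"
    and infX: "infinite {X' \<in> clifford_units n. conj X' = conj X}"
    using pigeonhole_infinite[OF inf] by blast
  have "{X' \<in> clifford_units n. conj X' = conj X} \<subseteq> {X, - X}"
  proof
    fix X' assume "X' \<in> {X' \<in> clifford_units n. conj X' = conj X}"
    then have X': "X' \<in> clifford_units n" "conj X' = conj X" by auto
    have "X' = X \<or> X' = - X"
      using conj[OF X] conj[OF X'(1)] unfolding X'(2)
      by (intro clifford_units_eq_up_to_sign[OF assms X X'(1)]) blast
    then show "X' \<in> {X, - X}" by blast
  qed
  then show False using infX finite_subset by blast
qed

subsection \<open>Elements of the Hecke algebra as operators\<close>

lemma hgen_lincomb:
  "hgen n i (\<lambda>u. x * v u + y * w u) = (\<lambda>u. x * hgen n i v u + y * hgen n i w u)"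
  by (simp add: hgen_def fun_eq_iff algebra_simps)

lemma hunit_lincomb:
  "hunit n (\<lambda>u. x * v u + y * w u) = (\<lambda>u. x * hunit n v u + y * hunit n w u)"
  by (simp add: hunit_def fun_eq_iff)

lemma hunit_hgen: "hunit n (hgen n i v) = hgen n i v"
  by (simp add: hunit_def hgen_def fun_eq_iff)

lemma hgen_hunit: "i \<in> {1..<n} \<Longrightarrow> hgen n i (hunit n v) = hgen n i v"
  by (simp add: hunit_def hgen_def fun_eq_iff sgen_perms)

lemma hunit_hunit: "hunit n (hunit n v) = hunit n v"
  by (simp add: hunit_def fun_eq_iff)

lemma word_op_simps [simp]:
  "word_op n [] = hunit n" "word_op n (i # x) = hgen n i \<circ> word_op n x"
  by (simp_all add: word_op_def)

lemma word_op_lincomb: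
  "word_op n x (\<lambda>u. a * v u + b * w u) = (\<lambda>u. a * word_op n x v u + b * word_op n x w u)"
  by (induction x) (simp_all add: hunit_lincomb hgen_lincomb)

lemma hunit_word_op: "hunit n (word_op n x v) = word_op n x v"
  by (cases x) (simp_all add: hunit_hunit hunit_hgen)

lemma word_op_hunit: "word_op n x (hunit n v) = word_op n x v"
  by (induction x) (simp_all add: hunit_hunit)

lemma word_op_append: "word_op n (x @ y) v = word_op n x (word_op n y v)"
  by (induction x) (simp_all add: hunit_word_op)

lemma word_op_hgen:
  "i \<in> {1..<n} \<Longrightarrow> word_op n [i] v = hgen n i v"
  by (simp add: hgen_hunit)

lemma hecke_sub_word_op: "x \<in> lists {1..<m} \<Longrightarrow> word_op n x \<in> hecke_sub n m"
  unfolding hecke_sub_def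
  by (rule CollectI, rule exI[of _ "{x}"], rule exI[of _ "\<lambda>_. 1"]) simp

lemma hecke_sub_zero: "(\<lambda>v u. 0) \<in> hecke_sub n m"
  unfolding hecke_sub_def by (rule CollectI, rule exI[of _ "{}"]) simp

lemma hecke_sub_lincomb:
  assumes "a \<in> hecke_sub n m" "b \<in> hecke_sub n m"
  shows "(\<lambda>v u. x * a v u + y * b v u) \<in> hecke_sub n m"
proof -
  obtain V c where V: "finite V" "V \<subseteq> lists {1..<m}" "a = (\<lambda>v u. \<Sum>w\<in>V. c w * word_op n w v u)"
    using assms(1) unfolding hecke_sub_def by blast
  obtain W d where W: "finite W" "W \<subseteq> lists {1..<m}" "b = (\<lambda>v u. \<Sum>w\<in>W. d w * word_op n w v u)"
    using assms(2) unfolding hecke_sub_def by blast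
  define e where "e = (\<lambda>w. x * (if w \<in> V then c w else 0) + y * (if w \<in> W then d w else 0))"
  have "x * a v u + y * b v u = (\<Sum>w\<in>V \<union> W. e w * word_op n w v u)" for v u
  proof -
    have "a v u = (\<Sum>w\<in>V \<union> W. (if w \<in> V then c w else 0) * word_op n w v u)"
      unfolding V(3) using V W by (intro sum.mono_neutral_cong_left) auto
    moreover have "b v u = (\<Sum>w\<in>V \<union> W. (if w \<in> W then d w else 0) * word_op n w v u)"
      unfolding W(3) using V W by (intro sum.mono_neutral_cong_left) auto
    ultimately show ?thesis
      by (simp add: e_def sum_distrib_left sum.distrib algebra_simps)
  qed
  then show ?thesis
    unfolding hecke_sub_def
    using V W by (intro CollectI exI[of _ "V \<union> W"] exI[of _ e]) auto
qed

lemma hecke_sub_induct [consumes 1, case_names zero word lincomb]: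
  assumes "a \<in> hecke_sub n m" "P (\<lambda>v u. 0)"
    and word: "\<And>w. w \<in> lists {1..<m} \<Longrightarrow> P (word_op n w)"
    and lincomb: "\<And>a b x y. a \<in> hecke_sub n m \<Longrightarrow> b \<in> hecke_sub n m \<Longrightarrow> P a \<Longrightarrow> P b \<Longrightarrow>
      P (\<lambda>v u. x * a v u + y * b v u)"
  shows "P a"
proof -
  obtain W c where W: "finite W" "W \<subseteq> lists {1..<m}" "a = (\<lambda>v u. \<Sum>w\<in>W. c w * word_op n w v u)"
    using assms(1) unfolding hecke_sub_def by blast
  have "(\<lambda>v u. \<Sum>w\<in>W. c w * word_op n w v u) \<in> hecke_sub n m \<and>
      P (\<lambda>v u. \<Sum>w\<in>W. c w * word_op n w v u)"
    using W(1,2)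
  proof (induction W rule: finite_induct)
    case empty
    then show ?case using assms(2) hecke_sub_zero by simp
  next
    case (insert w W)
    then have "word_op n w \<in> hecke_sub n m" "P (word_op n w)"
      using hecke_sub_word_op word by simp_all
    with insert show ?case
      using hecke_sub_lincomb[of "word_op n w" n m _ "c w" 1]
        lincomb[of "word_op n w" _ "c w" 1] by simp
  qed
  then show ?thesis using W(3) by simp
qed

lemma hecke_word_op_comp:
  assumes "a \<in> hecke n" "x \<in> lists {1..<n}"
  shows "word_op n x \<circ> a \<in> hecke n"
  using assms(1)
proof (induction rule: hecke_sub_induct)
  case zero
  have "word_op n x (\<lambda>u. 0) = (\<lambda>u. 0)"
    using word_op_lincomb[of n x 0 "\<lambda>u. 0" 0 "\<lambda>u. 0"] by simp
  then show ?case using hecke_sub_zero by (simp add: comp_def)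
next
  case (word w)
  have "word_op n x \<circ> word_op n w = word_op n (x @ w)"
    by (simp add: fun_eq_iff word_op_append)
  then show ?case using word assms(2) hecke_sub_word_op[of "x @ w" n n] by simp
next
  case (lincomb a b c d)
  have "word_op n x \<circ> (\<lambda>v u. c * a v u + d * b v u) =
      (\<lambda>v u. c * (word_op n x \<circ> a) v u + d * (word_op n x \<circ> b) v u)"
    by (simp add: comp_def word_op_lincomb)
  then show ?case using lincomb by (auto intro!: hecke_sub_lincomb)
qed

section \<open>Braid operators inside the Hecke algebra\<close>

definition linear_hop :: "hop \<Rightarrow> bool" where
  "linear_hop a \<longleftrightarrow> (\<forall>x y v w. a (\<lambda>u. x * v u + y * w u) = (\<lambda>u. x * a v u + y * a w u))"

lemma braid_op_Nil: "braid_op n [] = hunit n"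
  and braid_op_True: "braid_op n ((i, True) # bs) = hgen n i \<circ> braid_op n bs"
  and braid_op_False: "braid_op n ((i, False) # bs) = hinv n i \<circ> braid_op n bs"
  by (simp_all add: braid_op_def)

lemma hunit_braid_op: "hunit n (braid_op n bs v) = braid_op n bs v"
proof (cases bs)
  case (Cons b bs')
  then show ?thesis
    by (cases b; cases "snd b")
       (auto simp: braid_op_True braid_op_False hinv_def fun_eq_iff hunit_def hgen_def)
qed (simp add: braid_op_Nil hunit_hunit)

lemma hinv_lincomb:
  "hinv n i (\<lambda>u. x * v u + y * w u) = (\<lambda>u. x * hinv n i v u + y * hinv n i w u)"
  by (simp add: hinv_def fun_eq_iff hgen_lincomb hunit_lincomb algebra_simps add_divide_distrib diff_divide_distrib)

text \<open>\<open>hunit\<close> is the projection onto functions supported on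
  \<open>perms n\<close> and acts as a unit only there, hence the assumption.\<close>

lemma hinv_eq:
  assumes "hunit n v = v"
  shows "hinv n i v = (\<lambda>u. (1 / hq) * hgen n i v u + (- (hq - 1) / hq) * v u)"
proof
  fix u
  have "(g - c * x) / q = (1 / q) * g + (- c / q) * x" for g c x q :: complex
    by (simp add: diff_divide_distrib)
  then show "hinv n i v u = (1 / hq) * hgen n i v u + (- (hq - 1) / hq) * v u"
    unfolding hinv_def assms .
qed

lemma linear_hop_braid_op: "linear_hop (braid_op n bs)"
proof (induction bs)
  case Nil
  then show ?case by (simp add: linear_hop_def braid_op_Nil hunit_lincomb)
next
  case (Cons b bs)
  obtain i s where "b = (i, s)" by (cases b)
  then show ?case using Cons
    by (cases s) (simp_all add: linear_hop_def braid_op_True braid_op_False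
        hgen_lincomb hinv_lincomb)
qed

lemma hecke_braid_op_comp:
  assumes "a \<in> hecke n" "bs \<in> lists ({1..<n} \<times> UNIV)"
    and a: "\<And>v. hunit n (a v) = a v"
  shows "braid_op n bs \<circ> a \<in> hecke n"
  using assms(2)
proof (induction bs)
  case Nil
  have "hunit n \<circ> a = a" using a by (simp add: fun_eq_iff)
  then show ?case using assms(1) by (simp add: braid_op_Nil)
next
  case (Cons b bs)
  obtain i s where b: "b = (i, s)" by (cases b)
  let ?c = "braid_op n bs \<circ> a"
  have i: "i \<in> {1..<n}" using Cons.hyps b by auto
  have c: "?c \<in> hecke n" using Cons.IH .
  have "word_op n [i] \<circ> ?c \<in> hecke n" using i by (intro hecke_word_op_comp c) auto
  moreover have "word_op n [i] \<circ> ?c = hgen n i \<circ> ?c"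
    using word_op_hgen[OF i] by (simp add: comp_def)
  ultimately have g: "hgen n i \<circ> ?c \<in> hecke n" by simp
  have "hinv n i \<circ> ?c = (\<lambda>v u. (1 / hq) * (hgen n i \<circ> ?c) v u + (- (hq - 1) / hq) * ?c v u)"
    by (rule ext) (simp only: comp_apply hinv_eq hunit_braid_op)
  then have "hinv n i \<circ> ?c \<in> hecke n" using hecke_sub_lincomb[OF g c] by (simp only:)
  then show ?case
    using g unfolding b by (cases s) (simp_all only: braid_op_True braid_op_False comp_assoc)
qed

lemma braid_op_hecke:
  assumes "bs \<in> lists ({1..<n} \<times> UNIV)"
  shows "braid_op n bs \<in> hecke n"
proof -
  have h: "hunit n \<in> hecke n" using hecke_sub_word_op[of "[]" n n] by simp
  have "braid_op n bs (hunit n v) = braid_op n bs v" for v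
    using assms
  proof (induction bs)
    case (Cons b bs)
    then show ?case
      by (cases b; cases "snd b") (auto simp: braid_op_True braid_op_False)
  qed (simp add: braid_op_Nil hunit_hunit)
  then have "braid_op n bs \<circ> hunit n = braid_op n bs" by (simp add: fun_eq_iff)
  then show ?thesis using hecke_braid_op_comp[OF h assms] by (simp add: hunit_hunit)
qed

subsection \<open>The Markov trace on words\<close>

lemma hq_cube: "hq ^ 3 = - 1"
  by (simp add: hq_def DeMoivre)

lemma hq_square: "hq ^ 2 = hq - 1"
proof -
  have eq: "hq = Complex (1 / 2) (sqrt 3 / 2)"
    by (simp add: hq_def complex_eq_iff cos_60 sin_60)
  show ?thesis unfolding power2_eq_square eq by (simp add: complex_eq_iff)
qed

lemma hq_nonzero: "hq \<noteq> 0" "1 + hq \<noteq> 0"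
proof -
  show "hq \<noteq> 0" using hq_cube by auto
  show "1 + hq \<noteq> 0"
  proof
    assume "1 + hq = 0"
    then have "hq = - 1" by (simp add: add_eq_0_iff)
    from hq_square[unfolded this] show False by simp
  qed
qed

text \<open>By \<open>hq ^ 3 = - 1\<close>, the power with exponent \<open>1 - 3\<close> is
  \<open>- hq\<close>, so the numerator is \<open>1 + hq\<close> and the denominator twice
  that.\<close>

lemma heta_eq: "heta = 1 / 2"
proof -
  have "hq powi (1 - 3) = inverse (hq ^ 2)"
    by (simp add: power_int_def power_inverse)
  moreover have "inverse (hq ^ 2) = - hq"
    using hq_cube by (intro inverse_unique) (simp add: power2_eq_square power3_eq_cube)
  ultimately have "heta = (1 + hq) / ((1 + hq) * 2)"
    using hq_cube by (simp add: heta_def Let_def power_int_def)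
  also have "\<dots> = 1 / 2"
    using hq_nonzero(2) by (rule nonzero_divide_mult_cancel_left)
  finally show ?thesis .
qed

lemma markov_trace_lincomb:
  assumes "markov_trace n tr" "a \<in> hecke n" "b \<in> hecke n"
  shows "tr (\<lambda>v u. x * a v u + y * b v u) = x * tr a + y * tr b"
  using assms unfolding markov_trace_def by blast

lemma word_op_quadratic:
  assumes "i \<in> {1..<n}"
  shows "word_op n (x @ i # i # y) =
    (\<lambda>v u. (hq - 1) * word_op n (x @ i # y) v u + hq * word_op n (x @ y) v u)"
proof
  fix v
  have "word_op n (i # i # y) v = (\<lambda>u. (hq - 1) * word_op n (i # y) v u + hq * word_op n y v u)"
    using hgen_quadratic[OF assms] by (simp add: fun_eq_iff hunit_word_op)
  then show "word_op n (x @ i # i # y) v =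
      (\<lambda>u. (hq - 1) * word_op n (x @ i # y) v u + hq * word_op n (x @ y) v u)"
    by (simp only: word_op_append word_op_lincomb)
qed

lemma word_op_braid:
  assumes "1 \<le> i" "Suc i < n"
  shows "word_op n (x @ i # Suc i # i # y) = word_op n (x @ Suc i # i # Suc i # y)"
proof
  fix v
  have "word_op n (i # Suc i # i # y) v = word_op n (Suc i # i # Suc i # y) v"
    using hgen_braid[OF assms] by (simp add: fun_eq_iff)
  then show "word_op n (x @ i # Suc i # i # y) v = word_op n (x @ Suc i # i # Suc i # y) v"
    by (simp only: word_op_append)
qed

lemma word_op_commute:
  assumes "i \<in> {1..<n}" "j \<in> {1..<n}" "Suc i < j"
  shows "word_op n (x @ i # j # y) = word_op n (x @ j # i # y)"
proof
  fix v
  have "word_op n (i # j # y) v = word_op n (j # i # y) v"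
    using hgen_commute[OF assms] by (simp add: fun_eq_iff)
  then show "word_op n (x @ i # j # y) v = word_op n (x @ j # i # y) v"
    by (simp only: word_op_append)
qed

lemma hecke_functional_trace:
  assumes "markov_trace n tr"
  shows "hecke_functional hq n (\<lambda>x. tr (word_op n x))"
  unfolding hecke_functional_def
proof (intro ballI conjI allI impI)
  fix x y assume xy: "x \<in> lists {1..<n}" "y \<in> lists {1..<n}"
  show "tr (word_op n (x @ i # i # y)) =
      (hq - 1) * tr (word_op n (x @ i # y)) + hq * tr (word_op n (x @ y))"
    if i: "i \<in> {1..<n}" for i
    unfolding word_op_quadratic[OF i]
    using xy i by (intro markov_trace_lincomb[OF assms] hecke_sub_word_op) auto
  show "tr (word_op n (x @ i # Suc i # i # y)) = tr (word_op n (x @ Suc i # i # Suc i # y))"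
    if "1 \<le> i \<and> Suc i < n" for i
    using word_op_braid[of i n x y] that by simp
  show "tr (word_op n (x @ i # j # y)) = tr (word_op n (x @ j # i # y))"
    if "i \<in> {1..<n}" "j \<in> {1..<n}" "Suc i < j" for i j
    using word_op_commute[OF that, of x y] by simp
qed

text \<open>Since \<open>g = q - (1 + q) e\<close> and the trace parameter is \<open>1 / 2\<close>,
  the factor is \<open>q - (1 + q) / 2 = (q - 1) / 2\<close>, and
  \<open>q - 1 = q ^ 2\<close>.\<close>

lemma trace_word_op_markov:
  assumes tr: "markov_trace n tr" and m: "m \<in> {1..<n}" and x: "x \<in> lists {1..<m}"
  shows "tr (word_op n (x @ [m])) = hq ^ 2 / 2 * tr (word_op n x)"
proof -
  have xn: "x \<in> lists {1..<n}" "x @ [m] \<in> lists {1..<n}"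
    using x m by (auto simp: in_lists_conv_set)
  have "(word_op n x \<circ> he n m) v =
      (\<lambda>u. (hq / (1 + hq)) * word_op n x v u + (- 1 / (1 + hq)) * word_op n (x @ [m]) v u)" for v
  proof -
    have "he n m v = (\<lambda>u. (hq / (1 + hq)) * hunit n v u + (- 1 / (1 + hq)) * word_op n [m] v u)"
      using word_op_hgen[OF m] by (simp add: he_def fun_eq_iff diff_divide_distrib)
    then show ?thesis
      by (simp only: comp_apply word_op_lincomb word_op_append word_op_hunit)
  qed
  then have "word_op n x \<circ> he n m =
      (\<lambda>v u. (hq / (1 + hq)) * word_op n x v u + (- 1 / (1 + hq)) * word_op n (x @ [m]) v u)"
    by (rule ext)
  then have "tr (word_op n x \<circ> he n m) =
      (hq / (1 + hq)) * tr (word_op n x) + (- 1 / (1 + hq)) * tr (word_op n (x @ [m]))"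
    using markov_trace_lincomb[OF tr hecke_sub_word_op[OF xn(1)] hecke_sub_word_op[OF xn(2)]]
    by (simp only:)
  moreover have "tr (word_op n x \<circ> he n m) = 1 / 2 * tr (word_op n x)"
    using tr m hecke_sub_word_op[OF x, of n] unfolding markov_trace_def heta_eq by auto
  ultimately show ?thesis
    using hq_nonzero by (simp add: hq_square field_simps)
qed

section \<open>Comparison with the canonical trace on words\<close>

definition gj_word :: "nat \<Rightarrow> nat list \<Rightarrow> gj_index set lop" where
  "gj_word n x = prod_list (map (gj_braid n) x)"

text \<open>The complex factor \<open>hq ^ 2\<close> of each letter is kept outside, because the
  operators have real scalars.\<close>

definition gj_trace :: "nat \<Rightarrow> nat list \<Rightarrow> complex" where
  "gj_trace n x = (hq ^ 2) ^ length x * of_real (coef (gj_word n x) {})"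

lemma gj_word_subalg: "x \<in> lists I \<Longrightarrow> gj_word n x \<in> subalg n (I \<times> UNIV)"
  unfolding gj_word_def
  by (induction x) (auto intro!: subalg_closed subalg_mult gj_braid_subalg)

lemma gj_word_append: "gj_word n (x @ y) = gj_word n x * gj_word n y"
  by (simp add: gj_word_def)

lemma gj_trace_commute: "gj_trace n (x @ y) = gj_trace n (y @ x)"
  using trace_mult_commute[of "gj_word n x" n UNIV "gj_word n y"]
    gj_word_subalg[of x UNIV n] gj_word_subalg[of y UNIV n]
  by (simp add: gj_trace_def gj_word_append add.commute)

lemma gj_trace_markov:
  assumes "m \<in> {1..<n}" "x \<in> lists {1..<m}"
  shows "gj_trace n (x @ [m]) = hq ^ 2 / 2 * gj_trace n x"
proof -
  have half: "coef (gj_word n x * gj_braid n m) {} = coef (gj_word n x) {} / 2"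
    using assms by (intro trace_gj_braid[OF gj_word_subalg[of x "{1..<m}"]]) auto
  have snoc: "gj_word n (x @ [m]) = gj_word n x * gj_braid n m"
    by (simp add: gj_word_def)
  show ?thesis unfolding gj_trace_def snoc half by simp
qed

text \<open>The braid and commutation relations preserve length, so they pass directly from
  \<open>gj_braid\<close>. In the quadratic relation \<open>(q - 1) q ^ 2 = q ^ 4 = - q\<close>
  matches the factors.\<close>

lemma hecke_functional_gj_trace: "hecke_functional hq n (gj_trace n)"
  unfolding hecke_functional_def
proof (intro ballI conjI allI impI)
  fix x y assume xy: "x \<in> lists {1..<n}" "y \<in> lists {1..<n}"
  show "gj_trace n (x @ i # i # y) = (hq - 1) * gj_trace n (x @ i # y) + hq * gj_trace n (x @ y)"
    if i: "i \<in> {1..<n}" for i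
  proof -
    have "gj_word n (i # i # y) = gj_word n (i # y) - gj_word n y"
      using gj_braid_square[of i n] i by (simp add: gj_word_def left_diff_distrib flip: mult.assoc)
    then have "gj_word n (x @ i # i # y) = gj_word n (x @ i # y) - gj_word n (x @ y)"
      by (simp only: gj_word_append right_diff_distrib)
    then have c: "coef (gj_word n (x @ i # i # y)) {} =
        coef (gj_word n (x @ i # y)) {} - coef (gj_word n (x @ y)) {}"
      by simp
    define P a b where "P = (hq ^ 2) ^ (length x + length y)"
      and "a = complex_of_real (coef (gj_word n (x @ i # y)) {})"
      and "b = complex_of_real (coef (gj_word n (x @ y)) {})"
    have "hq ^ 2 * hq ^ 2 = hq ^ 3 * hq" by (simp add: eval_nat_numeral)
    then have z: "hq ^ 2 * hq ^ 2 = - hq" using hq_cube by simp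
    have "gj_trace n (x @ i # i # y) = P * ((hq ^ 2 * hq ^ 2) * (a - b))"
      unfolding gj_trace_def c P_def a_def b_def by (simp add: power_add)
    moreover have "gj_trace n (x @ i # y) = P * (hq ^ 2 * a)" "gj_trace n (x @ y) = P * b"
      unfolding gj_trace_def P_def a_def b_def by (simp_all add: power_add)
    moreover have "(hq - 1) * (P * (hq ^ 2 * a)) = P * ((hq ^ 2 * hq ^ 2) * a)"
      unfolding hq_square[symmetric] by (simp only: mult.assoc mult.left_commute[of _ P])
    ultimately show ?thesis
      unfolding z by (simp only: right_diff_distrib mult_minus_left) simp
  qed
  show "gj_trace n (x @ i # Suc i # i # y) = gj_trace n (x @ Suc i # i # Suc i # y)"
    if "1 \<le> i \<and> Suc i < n" for i
  proof -
    have "gj_word n (i # Suc i # i # y) = gj_word n (Suc i # i # Suc i # y)"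
      using gj_braid_braid[of i n] that by (simp add: gj_word_def flip: mult.assoc)
    then show ?thesis by (simp add: gj_trace_def gj_word_append)
  qed
  show "gj_trace n (x @ i # j # y) = gj_trace n (x @ j # i # y)"
    if "i \<in> {1..<n}" "j \<in> {1..<n}" "Suc i < j" for i j
  proof -
    have "gj_word n (i # j # y) = gj_word n (j # i # y)"
      using gj_braid_commute[of i n j] that by (simp add: gj_word_def flip: mult.assoc)
    then show ?thesis by (simp add: gj_trace_def gj_word_append)
  qed
qed

text \<open>The difference of the two sides is a cyclic Hecke functional with the same Markov
  constant and vanishes on the empty word, so uniqueness applies.\<close>

lemma trace_word_op_eq_gj_trace:
  assumes tr: "markov_trace n tr" and x: "x \<in> lists {1..<n}"
  shows "tr (word_op n x) = gj_trace n x"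
proof -
  let ?d = "\<lambda>x. tr (word_op n x) - gj_trace n x"
  have "?d x = 0"
  proof (rule markov_functional_vanishes[OF _ _ _ _ x])
    show "hecke_functional hq n ?d"
      by (intro hecke_functional_diff hecke_functional_trace[OF tr] hecke_functional_gj_trace)
    show "?d [] = 0"
      using tr by (simp add: markov_trace_def gj_trace_def gj_word_def coef_one)
    show "?d (x @ y) = ?d (y @ x)" if "x \<in> lists {1..<n}" "y \<in> lists {1..<n}" for x y
    proof -
      have "word_op n (x @ y) = word_op n x \<circ> word_op n y" for x y
        by (simp add: fun_eq_iff word_op_append)
      then have "tr (word_op n (x @ y)) = tr (word_op n (y @ x))"
        using tr that hecke_sub_word_op unfolding markov_trace_def by metis
      then show ?thesis by (simp add: gj_trace_commute[of n x])
    qed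
    show "?d (x @ [m]) = hq ^ 2 / 2 * ?d x" if "m \<in> {1..<n}" "x \<in> lists {1..<m}" for x m
      by (simp only: trace_word_op_markov[OF tr that] gj_trace_markov[OF that] right_diff_distrib)
  qed
  then show ?thesis by simp
qed

subsection \<open>Braids\<close>

text \<open>\<open>1 - gj_braid n i\<close> is the inverse of \<open>gj_braid n i\<close>.\<close>

definition gj_signed_word :: "nat \<Rightarrow> (nat \<times> bool) list \<Rightarrow> gj_index set lop" where
  "gj_signed_word n bs = prod_list (map (\<lambda>(i, b). if b then gj_braid n i else 1 - gj_braid n i) bs)"

text \<open>Inverses carry the factor \<open>- hq\<close> because \<open>hq\<^sup>2 * (- hq) = 1\<close>.\<close>

definition gj_phase :: "(nat \<times> bool) list \<Rightarrow> complex" where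
  "gj_phase bs = prod_list (map (\<lambda>(i, b). if b then hq ^ 2 else - hq) bs)"

text \<open>The induction absorbs letters of \<open>bs\<close> into the prefix \<open>x\<close>,
  which is therefore arbitrary. An inverse letter is a combination of \<open>g\<close> and the unit,
  and \<open>(q ^ 2 h) / q - (q - 1) / q = - q (1 - h)\<close> is its phase times the inverse of
  \<open>h\<close>.\<close>

lemma trace_braid_op:
  assumes tr: "markov_trace n tr" and bs: "bs \<in> lists ({1..<n} \<times> UNIV)"
    and x: "x \<in> lists {1..<n}" and y: "y \<in> lists {1..<n}"
  shows "tr (word_op n x \<circ> braid_op n bs \<circ> word_op n y) =
    (hq ^ 2) ^ (length x + length y) * gj_phase bs *
      of_real (coef (gj_word n x * gj_signed_word n bs * gj_word n y) {})"
  using bs x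
proof (induction bs arbitrary: x rule: list.induct)
  case Nil
  have eq: "word_op n x \<circ> braid_op n [] \<circ> word_op n y = word_op n (x @ y)"
    by (simp add: fun_eq_iff braid_op_Nil word_op_append hunit_word_op)
  show ?case
    unfolding eq using trace_word_op_eq_gj_trace[OF tr, of "x @ y"] Nil y
    by (simp add: gj_trace_def gj_word_append gj_phase_def gj_signed_word_def)
next
  case (Cons b bs)
  obtain i s where b: "b = (i, s)" by (cases b)
  have i: "i \<in> {1..<n}" and bs: "bs \<in> lists ({1..<n} \<times> UNIV)" and xi: "x @ [i] \<in> lists {1..<n}"
    using Cons.prems b by auto
  let ?c = "braid_op n bs \<circ> word_op n y"
  have c: "?c \<in> hecke n"
    using hecke_braid_op_comp[OF hecke_sub_word_op[OF y] bs] by (simp add: hunit_word_op)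
  have xi_op: "word_op n (x @ [i]) v = word_op n x (hgen n i v)" for v
    by (simp only: word_op_append word_op_hgen[OF i])
  define Z where "Z = gj_signed_word n bs * gj_word n y"
  have gx: "gj_word n (x @ [i]) = gj_word n x * gj_braid n i"
    by (simp add: gj_word_append gj_word_def)
  have IH: "tr (word_op n (x @ [i]) \<circ> ?c) = (hq ^ 2) ^ (length x + length y) * hq ^ 2 *
      gj_phase bs * of_real (coef (gj_word n x * gj_braid n i * Z) {})"
    unfolding comp_assoc[symmetric] Cons.IH[OF bs xi] by (simp add: Z_def gx mult.assoc)
  have IH0: "tr (word_op n x \<circ> ?c) = (hq ^ 2) ^ (length x + length y) *
      gj_phase bs * of_real (coef (gj_word n x * Z) {})"
    unfolding comp_assoc[symmetric] Cons.IH[OF bs Cons.prems(2)] by (simp add: Z_def mult.assoc)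
  show ?case
  proof (cases s)
    case True
    have eq: "word_op n x \<circ> braid_op n (b # bs) \<circ> word_op n y = word_op n (x @ [i]) \<circ> ?c"
      using xi_op by (simp add: fun_eq_iff b True braid_op_True)
    show ?thesis
      unfolding eq IH by (simp add: b True gj_phase_def gj_signed_word_def Z_def mult.assoc)
  next
    case False
    have hinv: "hinv n i (?c v) = (\<lambda>u. (1 / hq) * hgen n i (?c v) u + (- (hq - 1) / hq) * ?c v u)" for v
      by (simp only: comp_apply hinv_eq hunit_braid_op)
    have eq: "word_op n x \<circ> braid_op n (b # bs) \<circ> word_op n y =
        (\<lambda>v u. (1 / hq) * (word_op n (x @ [i]) \<circ> ?c) v u + (- (hq - 1) / hq) * (word_op n x \<circ> ?c) v u)"
    proof
      fix v
      have "(word_op n x \<circ> braid_op n (b # bs) \<circ> word_op n y) v = word_op n x (hinv n i (?c v))"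
        by (simp add: b False braid_op_False)
      also have "\<dots> = (\<lambda>u. (1 / hq) * (word_op n (x @ [i]) \<circ> ?c) v u +
          (- (hq - 1) / hq) * (word_op n x \<circ> ?c) v u)"
        unfolding hinv word_op_lincomb by (simp only: xi_op comp_apply)
      finally show "(word_op n x \<circ> braid_op n (b # bs) \<circ> word_op n y) v = \<dots>" .
    qed
    have "tr (word_op n x \<circ> braid_op n (b # bs) \<circ> word_op n y) =
        (1 / hq) * tr (word_op n (x @ [i]) \<circ> ?c) + (- (hq - 1) / hq) * tr (word_op n x \<circ> ?c)"
      unfolding eq
      by (intro markov_trace_lincomb[OF tr] hecke_word_op_comp c xi Cons.prems(2))
    also have "\<dots> = (hq ^ 2) ^ (length x + length y) * gj_phase bs *
        ((hq ^ 2 / hq) * of_real (coef (gj_word n x * gj_braid n i * Z) {}) +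
         (- (hq - 1) / hq) * of_real (coef (gj_word n x * Z) {}))"
    proof -
      have "(1 / q) * (P * s * g * a) + r * (P * g * b) = P * g * ((s / q) * a + r * b)"
        for q P s g a r b :: complex
        by (simp add: distrib_left)
      then show ?thesis unfolding IH IH0 .
    qed
    also have "hq ^ 2 / hq = hq" using hq_nonzero by (simp add: power2_eq_square)
    also have "- (hq - 1) / hq = - hq"
      using hq_nonzero by (simp add: power2_eq_square flip: hq_square)
    also have "hq * of_real (coef (gj_word n x * gj_braid n i * Z) {}) +
        - hq * of_real (coef (gj_word n x * Z) {}) =
        - hq * of_real (coef (gj_word n x * (1 - gj_braid n i) * Z) {})"
      by (simp add: ring_distribs)
    finally show ?thesis
      by (simp add: b False gj_phase_def gj_signed_word_def Z_def mult.assoc)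
  qed
qed

lemma gj_signed_word_clifford:
  assumes "n \<ge> 1" "bs \<in> lists ({1..<n} \<times> UNIV)"
  shows "gj_signed_word n bs \<in> clifford_units n"
  using assms(2)
proof (induction bs)
  case Nil
  have "1 \<in> clifford_units n"
    using clifford_one[of n] by (auto simp: clifford_units_def intro!: exI[of _ 1])
  then show ?case by (simp add: gj_signed_word_def)
next
  case (Cons b bs)
  then show ?case
    by (auto simp: gj_signed_word_def intro!: clifford_units_mult clifford_units_gj_braid
        split: prod.split)
qed

lemma gj_phase_cube: "gj_phase bs ^ 3 = 1"
proof (induction bs)
  case (Cons b bs)
  have "(hq ^ 2) ^ 3 = 1"
    by (subst power_mult[symmetric], subst mult.commute, subst power_mult) (simp add: hq_cube)
  moreover have "(- hq) ^ 3 = 1" using hq_cube by simp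
  ultimately show ?case
    using Cons by (cases b) (simp add: gj_phase_def power_mult_distrib)
qed (simp add: gj_phase_def)

text \<open>By linearity in \<open>c\<close> it suffices to test words, where the trace depends on
  \<open>bs\<close> only through its phase and signed word.\<close>

lemma trace_braid_op_hecke_cong:
  assumes tr: "markov_trace n tr"
    and bs: "bs \<in> lists ({1..<n} \<times> UNIV)" and bs': "bs' \<in> lists ({1..<n} \<times> UNIV)"
    and eq: "gj_phase bs = gj_phase bs'" "gj_signed_word n bs = gj_signed_word n bs'"
    and c: "c \<in> hecke n"
  shows "tr (braid_op n bs \<circ> c) = tr (braid_op n bs' \<circ> c)"
proof -
  have comp_word: "braid_op n cs \<circ> word_op n w = word_op n [] \<circ> braid_op n cs \<circ> word_op n w" for cs w
    by (simp add: fun_eq_iff hunit_braid_op)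
  have lin: "braid_op n cs \<circ> (\<lambda>v u. x * a v u + y * b v u) =
      (\<lambda>v u. x * (braid_op n cs \<circ> a) v u + y * (braid_op n cs \<circ> b) v u)" for cs a b x y
    using linear_hop_braid_op[of n cs] by (simp add: linear_hop_def comp_def)
  have comp_zero: "braid_op n cs \<circ> (\<lambda>v u. 0) = (\<lambda>v u. 0)" for cs
    using lin[of cs 0 "\<lambda>v u. 0" 0 "\<lambda>v u. 0"] by simp
  \<comment> \<open>The support property of \<open>c\<close> is carried along because
    \<open>hecke_braid_op_comp\<close> asks for it in the linear step.\<close>
  have "(\<forall>v. hunit n (c v) = c v) \<and> tr (braid_op n bs \<circ> c) = tr (braid_op n bs' \<circ> c)"
    using c
  proof (induction rule: hecke_sub_induct)
    case zero
    show ?case by (simp add: comp_zero hunit_def fun_eq_iff)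
  next
    case (word w)
    have "[] \<in> lists {1..<n}" by simp
    then show ?case
      unfolding comp_word trace_braid_op[OF tr bs \<open>[] \<in> _\<close> word]
        trace_braid_op[OF tr bs' \<open>[] \<in> _\<close> word] eq
      by (simp add: hunit_word_op)
  next
    case (lincomb a b x y)
    have hunit: "hunit n (a v) = a v" "hunit n (b v) = b v" for v
      using lincomb.IH by blast+
    have "tr (braid_op n cs \<circ> (\<lambda>v u. x * a v u + y * b v u)) =
        x * tr (braid_op n cs \<circ> a) + y * tr (braid_op n cs \<circ> b)"
      if "cs \<in> lists ({1..<n} \<times> UNIV)" for cs
      unfolding lin
      by (intro markov_trace_lincomb[OF tr] hecke_braid_op_comp lincomb.hyps that hunit)
    from this[OF bs] this[OF bs'] lincomb.IH show ?case
      by (simp only: hunit_lincomb hunit simp_thms)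
  qed
  then show ?thesis by blast
qed

theorem theorem3p1:
  fixes n :: nat and tr :: "hop \<Rightarrow> complex"
  assumes "n \<ge> 2" and "markov_trace n tr"
  shows "finite (braid_image n // ann_rel n tr)"
proof -
  define B where "B = lists ({1..<n} \<times> (UNIV :: bool set))"
  \<comment> \<open>The key takes finitely many values: a cube root of unity paired with a Clifford
    unit.\<close>
  define key where "key = (\<lambda>bs. (gj_phase bs, gj_signed_word n bs))"
  define cls where "cls = (\<lambda>bs. ann_rel n tr `` {braid_op n bs})"
  have "key ` B \<subseteq> {z. z ^ 3 = 1} \<times> clifford_units n"
  proof (rule image_subsetI)
    fix bs assume "bs \<in> B"
    then have "gj_signed_word n bs \<in> clifford_units n"
      using assms(1) by (intro gj_signed_word_clifford) (simp_all add: B_def)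
    then show "key bs \<in> {z. z ^ 3 = 1} \<times> clifford_units n"
      by (simp add: key_def gj_phase_cube)
  qed
  then have fin: "finite (key ` B)"
    by (rule finite_subset)
       (use assms(1) in \<open>intro finite_cartesian_product finite_roots_unity finite_clifford_units; simp\<close>)
  \<comment> \<open>Equal keys give equal traces against every element of the Hecke algebra, that
    is, equal classes modulo the annihilator.\<close>
  have cong: "cls bs = cls bs'" if "bs \<in> B" "bs' \<in> B" "key bs = key bs'" for bs bs'
    using that trace_braid_op_hecke_cong[OF assms(2), of bs bs'] braid_op_hecke
    by (auto simp: cls_def ann_rel_def key_def B_def)
  have "cls ` B \<subseteq> (\<lambda>k. cls (inv_into B key k)) ` key ` B"
  proof (rule image_subsetI)
    fix bs assume bs: "bs \<in> B"
    then have k: "key bs \<in> key ` B" by (rule imageI)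
    have "cls bs = cls (inv_into B key (key bs))"
      by (rule cong[OF bs inv_into_into[OF k]]) (rule f_inv_into_f[OF k, symmetric])
    then show "cls bs \<in> (\<lambda>k. cls (inv_into B key k)) ` key ` B"
      using k by (rule image_eqI)
  qed
  then have "finite (cls ` B)"
    using fin finite_subset by blast
  moreover have "braid_image n // ann_rel n tr = cls ` B"
    by (auto simp: quotient_def braid_image_def cls_def B_def)
  ultimately show ?thesis by simp
qed

end
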